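(* Let $x=(x_t(s,a))$ be any optimal occupation measure and $\{\mathcal{P}_t\}_{t\in[T]}$ any priority-score functions, and let $\pi$ be the corresponding fluid-priority policy. Then $\pi$ is diffusion regular (with respect to $x$), and its optimality gap satisfies $V_N^*-V_N(\pi)=O(\sqrt N)$ as $N\to\infty$.
   Context: Model. Fix, independently of $N$: a finite set $S$ (single-arm states), $A=\{0,1\}$ ($1$ = pull, $0$ = idle), a horizon $T$, $[T]=\{1,\dots,T\}$, transition kernels $p_t(s,a,s')$, rewards $r_t:S\times A\to\mathbb{R}$, rational budget ratios $\alpha_t\in[0,1]$, and an initial state $s^*\in S$. $N$ ranges over positive integers for which $\alpha_t N$ is an integer for all $t\in[T]$. There are $N$ arms, all in state $s^*$ at time $1$. At each time $t\in[T]$ every arm $i$ with state $s_{t,i}$ receives an action $a_{t,i}\in A$ chosen based on the current states and $t$; then, conditionally independently across arms, arm $i$ moves to state $s'$ with probability $p_t(s_{t,i},a_{t,i},s')$. The total reward at time $t$ is $R_t=\sum_{i=1}^N r_t(s_{t,i},a_{t,i})$. The budget constraint requires that exactly $\alpha_tN$ arms are pulled at each time $t$. Let $Z^N_t(s)$ be the number of arms in state $s$ at time $t$ and $X^N_t(s,a)$ the number of arms in state $s$ to which action $a$ is applied at time $t$. A policy $\pi$ is identified with maps (for each $N$ and $t$) $Z^N_t\mapsto X^N_t=\pi(t,Z^N_t)$ with $\sum_{a}X^N_t(s,a)=Z^N_t(s)$ and $\sum_s X^N_t(s,1)=\alpha_tN$. Its value is $V_N(\pi)=\mathbb{E}_\pi\sum_{t=1}^T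 R_t$, and $V_N^*=\sup_\pi V_N(\pi)$ over policies satisfying the budget constraint. Optimal occupation measure. A solution $x=(x_t(s,a))_{t\in[T],s\in S,a\in A}$ of the linear program: maximize $\sum_{t=1}^T\sum_{s,a} r_t(s,a)x_t(s,a)$ subject to $\sum_a x_t(s,a)=\sum_{a}\sum_{s'} x_{t-1}(s',a)p_{t-1}(s',a,s)$ for all $s\in S$, $2\le t\le T$; $\sum_s x_t(s,1)=\alpha_t$ for $t\in[T]$; $\sum_a x_1(s^*,a)=1$; $\sum_{s,a}x_1(s,a)=1$; $x_t(s,a)\ge 0$. Write $x_t=(x_t(s,a))_{s,a}$, $z_t(s)=\sum_a x_t(s,a)$, $z_t=(z_t(s))_s$. Diffusion regularity. Fix an optimal occupation measure $x$. The diffusion statistics are $\tilde Z^N_t=(Z^N_t-Nz_t)/\sqrt N$ and $\tilde X^N_t=(X^N_t-Nx_t)/\sqrt N$. A policy induces maps $\tilde\pi_{t,N}$ by $\pi(t,Z^N_t)=X^N_t\iff\tilde\pi_{t,N}(\tilde Z^N_t)=\tilde X^N_t$, i.e. $\tilde\pi_{t,N}(\theta)=(\pi(t,Nz_t+\sqrt N\theta)-Nx_t)/\sqrt N$; here the rule $\pi(t,\cdot)$ is regarded as defined on all real vectors $Z\in\mathbb{R}_{\ge0}^S$ with $\sum_sZ(s)=N$ (for the fluid-priority policy, by the same formulas below), and $\tilde\pi_{t,N}(\theta)$ is defined for those $\theta\in\mathbb{R}^S$ with $Nz_t+\sqrt N\theta$ in that set. With $|\cdot|$ the $L^1$-norm,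 $\pi$ is diffusion regular if: (1) there is $C_1>0$ with $|\tilde\pi_{t,N}(\theta_1)-\tilde\pi_{t,N}(\theta_2)|\le C_1|\theta_1-\theta_2|$ for all $t,N,\theta_1,\theta_2$; (2) there is $C_2>0$ with $|\tilde\pi_{t,N}(0)|\le C_2$ for all $t,N$; (3) there is a map $\tilde\pi_{t,\infty}$ such that $\tilde\pi_{t,N}(\theta)\to\tilde\pi_{t,\infty}(\theta)$ as $N\to\infty$ for all $\theta$ (for which $\tilde\pi_{t,N}(\theta)$ is defined for all large $N$). Fluid-priority policy. Given an optimal occupation measure $x$ and priority-score functions $\mathcal{P}_t:S\to\mathbb{R}$, $t\in[T]$, set $C^+_t=\{s: x_t(s,1)>0,\ x_t(s,0)=0\}$ (fluid-active), $C^0_t=\{s:x_t(s,1)>0,\ x_t(s,0)>0\}$ (fluid-neutral), $C^-_t=\{s:x_t(s,1)=0\}$ (fluid-inactive). At time $t$, given counts $Z(s)$, start with $B=\alpha_tN$; in each of the following passes states are visited in decreasing order of $\mathcal{P}_t$ (ties broken in a fixed arbitrary way). (i) For $s\in C^+_t$: $X(s,1)\leftarrow\min\{B,Z(s)\}$, $B\leftarrow B-X(s,1)$. (ii) For $s\in C^0_t$: $X(s,1)\leftarrow\min\{B,Z(s),\lfloor Nx_t(s,1)\rfloor\}$, $U(s)\leftarrow Z(s)-X(s,1)$, $B\leftarrow B-X(s,1)$. (iii) For $s\in C^0_t$: let $m=\min\{B,U(s)\}$; $X(s,1)\leftarrow X(s,1)+m$, $B\leftarrow B-m$. (iv) For $s\in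 C^-_t$: $X(s,1)\leftarrow\min\{B,Z(s)\}$, $B\leftarrow B-X(s,1)$. Finally $X(s,0)=Z(s)-X(s,1)$ and $\pi(t,Z)=X$. *)

theory Defs
  imports "HOL-Probability.Probability" "HOL-Library.Landau_Symbols"
begin

text \<open>
  The single-arm state space is a finite type. Actions are Booleans: \<^term>\<open>True\<close> is pull (1) and
  \<^term>\<open>False\<close> is idle (0). Time ranges over \<open>{1..T}\<close>; time-indexed data
  outside this range are irrelevant.

  A rule maps a time \<open>t\<close> and a vector \<open>Z\<close> of (real) state counts to the counts \<open>X s a\<close> of arms
  in state \<open>s\<close> receiving action \<open>a\<close>. A policy is a family of rules indexed by the number \<open>N\<close>
  of arms. Counts are real-valued so that the same rule can be read both on genuine (integer)
  count vectors and on arbitrary nonnegative real vectors, as diffusion regularity requires.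
\<close>

type_synonym 's rule = "nat \<Rightarrow> ('s \<Rightarrow> real) \<Rightarrow> 's \<Rightarrow> bool \<Rightarrow> real"
type_synonym 's policy = "nat \<Rightarrow> 's rule"
type_synonym 's occupation = "nat \<Rightarrow> 's \<Rightarrow> bool \<Rightarrow> real"

definition arm_numbers :: "nat \<Rightarrow> (nat \<Rightarrow> real) \<Rightarrow> nat set" where
  "arm_numbers T \<alpha> = {N. N > 0 \<and> (\<forall>t\<in>{1..T}. \<alpha> t * real N \<in> \<int>)}"

definition to_infinity :: "nat \<Rightarrow> (nat \<Rightarrow> real) \<Rightarrow> nat filter" where
  "to_infinity T \<alpha> = inf at_top (principal (arm_numbers T \<alpha>))"


subsection \<open>The model with many arms\<close>

definition state_counts :: "nat \<Rightarrow> (nat \<Rightarrow> 's) \<Rightarrow> 's \<Rightarrow> real" where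
  "state_counts N \<sigma> s = real (card {i. i < N \<and> \<sigma> i = s})"

text \<open>
  A rule only says how many arms of each state are pulled. Arms in the same state are
  exchangeable, so it does not matter which ones; we pull those with the lowest indices.
\<close>

definition arm_action :: "nat \<Rightarrow> 's rule \<Rightarrow> nat \<Rightarrow> (nat \<Rightarrow> 's) \<Rightarrow> nat \<Rightarrow> bool" where
  "arm_action N \<rho> t \<sigma> i \<longleftrightarrow>
     real (card {j. j < i \<and> \<sigma> j = \<sigma> i}) < \<rho> t (state_counts N \<sigma>) (\<sigma> i) True"

text \<open>
  The law of the joint trajectory \<open>h t i\<close> (state of arm \<open>i\<close> at time \<open>t\<close>). The term
  \<open>trajectory p s0 N \<rho> n\<close> has sampled the times \<open>1, \<dots>, n + 1\<close>; the entries of \<open>h\<close> at other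
  times and for \<open>i \<ge> N\<close> are dummies.
\<close>

primrec trajectory ::
  "(nat \<Rightarrow> 's \<Rightarrow> bool \<Rightarrow> 's pmf) \<Rightarrow> 's \<Rightarrow> nat \<Rightarrow> 's rule \<Rightarrow> nat \<Rightarrow> (nat \<Rightarrow> nat \<Rightarrow> 's) pmf" where
  "trajectory p s0 N \<rho> 0 = return_pmf (\<lambda>t i. s0)"
| "trajectory p s0 N \<rho> (Suc n) =
     bind_pmf (trajectory p s0 N \<rho> n) (\<lambda>h.
       let \<sigma> = h (Suc n) in
       map_pmf (\<lambda>\<sigma>'. h(Suc (Suc n) := \<sigma>'))
         (Pi_pmf {..<N} s0 (\<lambda>i. p (Suc n) (\<sigma> i) (arm_action N \<rho> (Suc n) \<sigma> i))))"

definition policy_value ::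
  "nat \<Rightarrow> (nat \<Rightarrow> 's \<Rightarrow> bool \<Rightarrow> 's pmf) \<Rightarrow> (nat \<Rightarrow> 's \<Rightarrow> bool \<Rightarrow> real) \<Rightarrow> 's \<Rightarrow> nat \<Rightarrow> 's rule \<Rightarrow> real"
where
  "policy_value T p r s0 N \<rho> =
     measure_pmf.expectation (trajectory p s0 N \<rho> (T - 1))
       (\<lambda>h. \<Sum>t\<in>{1..T}. \<Sum>i<N. r t (h t i) (arm_action N \<rho> t (h t) i))"

definition feasible_rule ::
  "nat \<Rightarrow> (nat \<Rightarrow> real) \<Rightarrow> nat \<Rightarrow> ('s::finite) rule \<Rightarrow> bool" where
  "feasible_rule T \<alpha> N \<rho> \<longleftrightarrow>
     (\<forall>t\<in>{1..T}. \<forall>Z. (\<forall>s. Z s \<in> \<nat>) \<and> (\<Sum>s\<in>UNIV. Z s) = real N \<longrightarrow>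
        (\<forall>s a. \<rho> t Z s a \<in> \<nat>) \<and>
        (\<forall>s. (\<Sum>a\<in>UNIV. \<rho> t Z s a) = Z s) \<and>
        (\<Sum>s\<in>UNIV. \<rho> t Z s True) = \<alpha> t * real N)"

definition optimal_value ::
  "nat \<Rightarrow> (nat \<Rightarrow> ('s::finite) \<Rightarrow> bool \<Rightarrow> 's pmf) \<Rightarrow> (nat \<Rightarrow> 's \<Rightarrow> bool \<Rightarrow> real) \<Rightarrow> (nat \<Rightarrow> real) \<Rightarrow>
     's \<Rightarrow> nat \<Rightarrow> real"
where
  "optimal_value T p r \<alpha> s0 N =
     (SUP \<rho>\<in>{\<rho>. feasible_rule T \<alpha> N \<rho>}. policy_value T p r s0 N \<rho>)"


subsection \<open>Optimal occupation measures\<close>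

definition occupation_measure ::
  "nat \<Rightarrow> (nat \<Rightarrow> ('s::finite) \<Rightarrow> bool \<Rightarrow> 's pmf) \<Rightarrow> (nat \<Rightarrow> real) \<Rightarrow> 's \<Rightarrow> 's occupation \<Rightarrow> bool"
where
  "occupation_measure T p \<alpha> s0 x \<longleftrightarrow>
     (\<forall>t\<in>{2..T}. \<forall>s. (\<Sum>a\<in>UNIV. x t s a) =
        (\<Sum>a\<in>UNIV. \<Sum>s'\<in>UNIV. x (t - 1) s' a * pmf (p (t - 1) s' a) s)) \<and>
     (\<forall>t\<in>{1..T}. (\<Sum>s\<in>UNIV. x t s True) = \<alpha> t) \<and>
     (\<Sum>a\<in>UNIV. x 1 s0 a) = 1 \<and>
     (\<Sum>s\<in>UNIV. \<Sum>a\<in>UNIV. x 1 s a) = 1 \<and>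
     (\<forall>t\<in>{1..T}. \<forall>s a. x t s a \<ge> 0)"

definition fluid_reward ::
  "nat \<Rightarrow> (nat \<Rightarrow> ('s::finite) \<Rightarrow> bool \<Rightarrow> real) \<Rightarrow> 's occupation \<Rightarrow> real" where
  "fluid_reward T r x = (\<Sum>t\<in>{1..T}. \<Sum>s\<in>UNIV. \<Sum>a\<in>UNIV. r t s a * x t s a)"

definition optimal_occupation_measure ::
  "nat \<Rightarrow> (nat \<Rightarrow> ('s::finite) \<Rightarrow> bool \<Rightarrow> 's pmf) \<Rightarrow> (nat \<Rightarrow> 's \<Rightarrow> bool \<Rightarrow> real) \<Rightarrow> (nat \<Rightarrow> real) \<Rightarrow>
     's \<Rightarrow> 's occupation \<Rightarrow> bool"
where
  "optimal_occupation_measure T p r \<alpha> s0 x \<longleftrightarrow>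
     occupation_measure T p \<alpha> s0 x \<and>
     (\<forall>y. occupation_measure T p \<alpha> s0 y \<longrightarrow> fluid_reward T r y \<le> fluid_reward T r x)"


subsection \<open>Diffusion regularity\<close>

definition fluid_state :: "'s occupation \<Rightarrow> nat \<Rightarrow> 's \<Rightarrow> real" where
  "fluid_state x t s = (\<Sum>a\<in>UNIV. x t s a)"

definition undiffuse :: "'s occupation \<Rightarrow> nat \<Rightarrow> nat \<Rightarrow> ('s \<Rightarrow> real) \<Rightarrow> 's \<Rightarrow> real" where
  "undiffuse x t N \<theta> s = real N * fluid_state x t s + sqrt (real N) * \<theta> s"

definition diffusion_domain ::
  "('s::finite) occupation \<Rightarrow> nat \<Rightarrow> nat \<Rightarrow> ('s \<Rightarrow> real) set" where
  "diffusion_domain x t N =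
     {\<theta>. (\<forall>s. undiffuse x t N \<theta> s \<ge> 0) \<and> (\<Sum>s\<in>UNIV. undiffuse x t N \<theta> s) = real N}"

definition diffusion_map ::
  "'s policy \<Rightarrow> 's occupation \<Rightarrow> nat \<Rightarrow> nat \<Rightarrow> ('s \<Rightarrow> real) \<Rightarrow> 's \<Rightarrow> bool \<Rightarrow> real" where
  "diffusion_map \<pi> x t N \<theta> s a =
     (\<pi> N t (undiffuse x t N \<theta>) s a - real N * x t s a) / sqrt (real N)"

definition diffusion_regular ::
  "nat \<Rightarrow> (nat \<Rightarrow> real) \<Rightarrow> ('s::finite) occupation \<Rightarrow> 's policy \<Rightarrow> bool" where
  "diffusion_regular T \<alpha> x \<pi> \<longleftrightarrow>
     (\<exists>C1>0. \<forall>t\<in>{1..T}. \<forall>N\<in>arm_numbers T \<alpha>.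
        \<forall>\<theta>1\<in>diffusion_domain x t N. \<forall>\<theta>2\<in>diffusion_domain x t N.
          (\<Sum>s\<in>UNIV. \<Sum>a\<in>UNIV. \<bar>diffusion_map \<pi> x t N \<theta>1 s a - diffusion_map \<pi> x t N \<theta>2 s a\<bar>)
            \<le> C1 * (\<Sum>s\<in>UNIV. \<bar>\<theta>1 s - \<theta>2 s\<bar>)) \<and>
     (\<exists>C2>0. \<forall>t\<in>{1..T}. \<forall>N\<in>arm_numbers T \<alpha>.
        (\<Sum>s\<in>UNIV. \<Sum>a\<in>UNIV. \<bar>diffusion_map \<pi> x t N (\<lambda>s. 0) s a\<bar>) \<le> C2) \<and>
     (\<exists>L. \<forall>t\<in>{1..T}. \<forall>\<theta>.
        (\<forall>\<^sub>F N in to_infinity T \<alpha>. \<theta> \<in> diffusion_domain x t N) \<longrightarrow>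
        (\<forall>s a. ((\<lambda>N. diffusion_map \<pi> x t N \<theta> s a) \<longlongrightarrow> L t \<theta> s a) (to_infinity T \<alpha>)))"


subsection \<open>Fluid-priority policies\<close>

definition fluid_active :: "'s occupation \<Rightarrow> nat \<Rightarrow> 's set" where
  "fluid_active x t = {s. x t s True > 0 \<and> x t s False = 0}"

definition fluid_neutral :: "'s occupation \<Rightarrow> nat \<Rightarrow> 's set" where
  "fluid_neutral x t = {s. x t s True > 0 \<and> x t s False > 0}"

definition fluid_inactive :: "'s occupation \<Rightarrow> nat \<Rightarrow> 's set" where
  "fluid_inactive x t = {s. x t s True = 0}"

text \<open>
  An enumeration of all states by decreasing priority score; the list also records how ties
  are broken.
\<close>

definition priority_order :: "('s \<Rightarrow> real) \<Rightarrow> 's list \<Rightarrow> bool" where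
  "priority_order P ss \<longleftrightarrow>
     distinct ss \<and> set ss = UNIV \<and> sorted_wrt (\<lambda>s s'. P s \<ge> P s') ss"

text \<open>
  The passes act on pairs \<open>(B, Y)\<close> of the remaining budget \<open>B\<close> and the current pull counts
  \<open>Y s = X s True\<close>.
\<close>

fun pull_all :: "('s \<Rightarrow> real) \<Rightarrow> 's \<Rightarrow> real \<times> ('s \<Rightarrow> real) \<Rightarrow> real \<times> ('s \<Rightarrow> real)" where
  "pull_all Z s (B, Y) = (let m = min B (Z s) in (B - m, Y(s := m)))"

fun pull_target ::
  "('s \<Rightarrow> real) \<Rightarrow> ('s \<Rightarrow> real) \<Rightarrow> 's \<Rightarrow> real \<times> ('s \<Rightarrow> real) \<Rightarrow> real \<times> ('s \<Rightarrow> real)" where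
  "pull_target target Z s (B, Y) =
     (let m = min B (min (Z s) (target s)) in (B - m, Y(s := m)))"

fun pull_rest :: "('s \<Rightarrow> real) \<Rightarrow> 's \<Rightarrow> real \<times> ('s \<Rightarrow> real) \<Rightarrow> real \<times> ('s \<Rightarrow> real)" where
  "pull_rest Z s (B, Y) = (let m = min B (Z s - Y s) in (B - m, Y(s := Y s + m)))"

definition fluid_priority_pulls ::
  "(nat \<Rightarrow> real) \<Rightarrow> 's occupation \<Rightarrow> (nat \<Rightarrow> 's list) \<Rightarrow> nat \<Rightarrow> nat \<Rightarrow> ('s \<Rightarrow> real) \<Rightarrow> 's \<Rightarrow> real"
where
  "fluid_priority_pulls \<alpha> x ord N t Z =
     (let visit = (\<lambda>f C. fold f (filter (\<lambda>s. s \<in> C) (ord t)));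
          st0 = (\<alpha> t * real N, \<lambda>s. 0);
          st1 = visit (pull_all Z) (fluid_active x t) st0;
          st2 = visit (pull_target (\<lambda>s. of_int \<lfloor>real N * x t s True\<rfloor>) Z) (fluid_neutral x t) st1;
          st3 = visit (pull_rest Z) (fluid_neutral x t) st2;
          st4 = visit (pull_all Z) (fluid_inactive x t) st3
      in snd st4)"

definition fluid_priority_policy ::
  "(nat \<Rightarrow> real) \<Rightarrow> 's occupation \<Rightarrow> (nat \<Rightarrow> 's list) \<Rightarrow> 's policy" where
  "fluid_priority_policy \<alpha> x ord N t Z s a =
     (let Y = fluid_priority_pulls \<alpha> x ord N t Z in if a then Y s else Z s - Y s)"

end

theory Submission
  imports Defs
begin

text \<open>
  A pass of the fluid-priority rule only adds, subtracts and takes minima of the remaining budget,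
  the state counts and the targets. The pull counts are therefore a Lipschitz function of these
  inputs, with a constant independent of the number \<open>N\<close> of arms (\<open>priority_passes_lipschitz\<close>). On
  the fluid input \<open>(N \<alpha>, N x, N z)\<close> the passes return exactly the fluid pulls \<open>N x\<close>
  (\<open>priority_passes_fluid\<close>), and rounding the targets down changes the input by at most 1 per state.

  Both parts of the theorem follow from these two facts. For diffusion regularity, scaling by
  \<open>sqrt N\<close> turns the Lipschitz bound into condition (1) and the bounded rounding error into
  condition (2). For condition (3), sequences of the form \<open>N c + sqrt N l + o(sqrt N)\<close> are closed
  under sums, differences and minima, so the pull counts inherit such an expansion from the
  inputs (\<open>priority_passes_expansion\<close>), with the leading coefficient given by the fluid input.

  For the optimality gap, the expected action frequencies of any feasible rule form an occupation
  measure (\<open>occupation_measure_mean_occupation\<close>), hence no value exceeds \<open>N\<close> times the optimum of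
  the linear program. Conversely the arms stay within order \<open>sqrt N\<close> of the fluid trajectory under
  the fluid-priority policy (\<open>policy_mean_deviation\<close>): each round of independent moves adds a
  fluctuation of mean size at most \<open>sqrt N\<close> per state, and the Lipschitz rule amplifies earlier deviations by a constant factor
  at each of the \<open>T\<close> steps. Since rewards are linear in the action counts, the value of the policy
  is at least \<open>N\<close> times the optimum minus a multiple of \<open>sqrt N\<close>. The gap is also nonnegative, since
  the policy is itself feasible (\<open>policy_feasible\<close>): it pulls integral numbers of arms and, as
  \<open>\<alpha> t \<le> 1\<close>, never runs out of arms before the budget is spent.
\<close>

section \<open>The priority passes as sums, differences and minima\<close>

text \<open>
  The four passes with the starting budget \<open>b\<close> and the targets \<open>\<tau>\<close> of the second pass as real
  parameters. Without the rounding in the targets, the fluid trajectory itself is an admissible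
  input, and the passes become a function of \<open>(b, \<tau>, Z)\<close> built from sums, differences and minima.
\<close>

definition priority_passes ::
  "'s set \<Rightarrow> 's set \<Rightarrow> 's set \<Rightarrow> 's list \<Rightarrow> real \<Rightarrow> ('s \<Rightarrow> real) \<Rightarrow> ('s \<Rightarrow> real) \<Rightarrow> real \<times> ('s \<Rightarrow> real)"
where
  "priority_passes C1 C0 C2 ss b \<tau> Z =
     fold (pull_all Z) (filter (\<lambda>s. s \<in> C2) ss)
       (fold (pull_rest Z) (filter (\<lambda>s. s \<in> C0) ss)
         (fold (pull_target \<tau> Z) (filter (\<lambda>s. s \<in> C0) ss)
           (fold (pull_all Z) (filter (\<lambda>s. s \<in> C1) ss) (b, \<lambda>s. 0))))"

lemma fluid_priority_pulls_eq_passes: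
  "fluid_priority_pulls \<alpha> x ord N t Z =
     snd (priority_passes (fluid_active x t) (fluid_neutral x t) (fluid_inactive x t) (ord t)
            (\<alpha> t * real N) (\<lambda>s. of_int \<lfloor>real N * x t s True\<rfloor>) Z)"
  by (simp add: fluid_priority_pulls_def priority_passes_def Let_def)

text \<open>
  A relation between families of reals that is compatible with the operations used by the passes
  is inherited by their outputs. Two instances are needed: a distance bounded by a multiple of the
  distance between the inputs, which gives the Lipschitz property, and the existence of an
  expansion \<open>N c + sqrt N l + o(sqrt N)\<close>, which gives the limit of the diffusion maps.
\<close>

locale arithmetic_relation =
  fixes Q :: "('i \<Rightarrow> real) \<Rightarrow> ('i \<Rightarrow> real) \<Rightarrow> bool"
  assumes zero: "Q (\<lambda>i. 0) (\<lambda>i. 0)"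
    and add: "Q f f' \<Longrightarrow> Q g g' \<Longrightarrow> Q (\<lambda>i. f i + g i) (\<lambda>i. f' i + g' i)"
    and diff: "Q f f' \<Longrightarrow> Q g g' \<Longrightarrow> Q (\<lambda>i. f i - g i) (\<lambda>i. f' i - g' i)"
    and min: "Q f f' \<Longrightarrow> Q g g' \<Longrightarrow> Q (\<lambda>i. min (f i) (g i)) (\<lambda>i. min (f' i) (g' i))"
begin

lemma cond:
  assumes "c \<Longrightarrow> Q f f'" "\<not> c \<Longrightarrow> Q g g'"
  shows "Q (\<lambda>i. if c then f i else g i) (\<lambda>i. if c then f' i else g' i)"
  using assms by (cases c) auto

definition related :: "('i \<Rightarrow> real \<times> ('s \<Rightarrow> real)) \<Rightarrow> ('i \<Rightarrow> real \<times> ('s \<Rightarrow> real)) \<Rightarrow> bool" where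
  "related S S' \<longleftrightarrow>
     Q (\<lambda>i. fst (S i)) (\<lambda>i. fst (S' i)) \<and> (\<forall>s. Q (\<lambda>i. snd (S i) s) (\<lambda>i. snd (S' i) s))"

lemma related_pull_all:
  assumes "related S S'" "\<And>s. Q (\<lambda>i. Z i s) (\<lambda>i. Z' i s)"
  shows "related (\<lambda>i. pull_all (Z i) s (S i)) (\<lambda>i. pull_all (Z' i) s (S' i))"
proof -
  have eq: "pull_all Z s st = (fst st - min (fst st) (Z s), (snd st)(s := min (fst st) (Z s)))"
    for Z s and st :: "real \<times> ('s \<Rightarrow> real)"
    by (cases st) (simp add: Let_def)
  show ?thesis
    using assms unfolding related_def eq by (auto intro!: diff min cond)
qed

lemma related_pull_target:
  assumes "related S S'" "\<And>s. Q (\<lambda>i. Z i s) (\<lambda>i. Z' i s)" "\<And>s. Q (\<lambda>i. \<tau> i s) (\<lambda>i. \<tau>' i s)"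
  shows "related (\<lambda>i. pull_target (\<tau> i) (Z i) s (S i)) (\<lambda>i. pull_target (\<tau>' i) (Z' i) s (S' i))"
proof -
  have eq: "pull_target \<tau> Z s st =
      (fst st - min (fst st) (min (Z s) (\<tau> s)), (snd st)(s := min (fst st) (min (Z s) (\<tau> s))))"
    for \<tau> Z s and st :: "real \<times> ('s \<Rightarrow> real)"
    by (cases st) (simp add: Let_def)
  show ?thesis
    using assms unfolding related_def eq by (auto intro!: diff min cond)
qed

lemma related_pull_rest:
  assumes "related S S'" "\<And>s. Q (\<lambda>i. Z i s) (\<lambda>i. Z' i s)"
  shows "related (\<lambda>i. pull_rest (Z i) s (S i)) (\<lambda>i. pull_rest (Z' i) s (S' i))"
proof -
  have eq: "pull_rest Z s st =
      (fst st - min (fst st) (Z s - snd st s),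
       (snd st)(s := snd st s + min (fst st) (Z s - snd st s)))"
    for Z s and st :: "real \<times> ('s \<Rightarrow> real)"
    by (cases st) (simp add: Let_def)
  show ?thesis
    using assms unfolding related_def eq by (auto intro!: diff min add cond)
qed

lemma related_fold:
  assumes "related S S'"
    and "\<And>s S S'. related S S' \<Longrightarrow> related (\<lambda>i. f i s (S i)) (\<lambda>i. f' i s (S' i))"
  shows "related (\<lambda>i. fold (f i) xs (S i)) (\<lambda>i. fold (f' i) xs (S' i))"
  using assms(1)
proof (induction xs arbitrary: S S')
  case (Cons s xs)
  from Cons.IH[OF assms(2)[OF Cons.prems]] show ?case by simp
qed simp

lemma related_priority_passes:
  assumes "Q b b'" "\<And>s. Q (\<lambda>i. \<tau> i s) (\<lambda>i. \<tau>' i s)" "\<And>s. Q (\<lambda>i. Z i s) (\<lambda>i. Z' i s)"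
  shows "related (\<lambda>i. priority_passes C1 C0 C2 ss (b i) (\<tau> i) (Z i))
                 (\<lambda>i. priority_passes C1 C0 C2 ss (b' i) (\<tau>' i) (Z' i))"
  unfolding priority_passes_def
  by (intro related_fold related_pull_all related_pull_target related_pull_rest assms)
     (simp_all add: related_def assms zero)

end

text \<open>
  The constant depends only on the three classes and the visiting order, so it serves all \<open>N\<close>.
  Take \<open>Q\<close> to relate families, indexed by pairs of inputs, whose difference is at most a constant
  times the distance \<open>d\<close> of the two inputs; the three inputs themselves have constant \<open>1\<close>.
\<close>

lemma priority_passes_lipschitz:
  fixes ss :: "'s::finite list"
  shows "\<exists>K\<ge>0. \<forall>b b' \<tau> \<tau>' Z Z' s.
    \<bar>snd (priority_passes C1 C0 C2 ss b \<tau> Z) s - snd (priority_passes C1 C0 C2 ss b' \<tau>' Z') s\<bar>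
      \<le> K * (\<bar>b - b'\<bar> + (\<Sum>s\<in>UNIV. \<bar>\<tau> s - \<tau>' s\<bar>) + (\<Sum>s\<in>UNIV. \<bar>Z s - Z' s\<bar>))"
proof -
  define d where "d = (\<lambda>(b::real, b', \<tau>, \<tau>', Z, Z').
    \<bar>b - b'\<bar> + (\<Sum>s\<in>(UNIV::'s set). \<bar>\<tau> s - \<tau>' s\<bar>) + (\<Sum>s\<in>(UNIV::'s set). \<bar>Z s - Z' s :: real\<bar>))"
  have d_nonneg: "d i \<ge> 0" for i
    by (auto simp: d_def split: prod.split intro!: add_nonneg_nonneg sum_nonneg)
  define Q where "Q = (\<lambda>f g. \<exists>K\<ge>0. \<forall>i. \<bar>f i - g i :: real\<bar> \<le> K * d i)"
  interpret arithmetic_relation Q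
  proof
    show "Q (\<lambda>i. 0) (\<lambda>i. 0)" by (auto simp: Q_def)
  next
    fix f f' g g' assume "Q f f'" "Q g g'"
    then obtain K L where K: "K \<ge> 0" "\<And>i. \<bar>f i - f' i\<bar> \<le> K * d i"
      and L: "L \<ge> 0" "\<And>i. \<bar>g i - g' i\<bar> \<le> L * d i"
      unfolding Q_def by blast
    have KL: "(K + L) * d i = K * d i + L * d i" for i by (simp add: algebra_simps)
    have "\<bar>(f i + g i) - (f' i + g' i)\<bar> \<le> (K + L) * d i" 
         "\<bar>(f i - g i) - (f' i - g' i)\<bar> \<le> (K + L) * d i"
         "\<bar>min (f i) (g i) - min (f' i) (g' i)\<bar> \<le> (K + L) * d i" for i
      unfolding KL using K(2)[of i] L(2)[of i] by linarith+
    moreover have "K + L \<ge> 0" using K L by simp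
    ultimately show "Q (\<lambda>i. f i + g i) (\<lambda>i. f' i + g' i)" "Q (\<lambda>i. f i - g i) (\<lambda>i. f' i - g' i)"
      "Q (\<lambda>i. min (f i) (g i)) (\<lambda>i. min (f' i) (g' i))"
      unfolding Q_def by blast+
  qed
  \<comment> \<open>An index consists of the two budgets, the two targets and the two state vectors.\<close>
  have coord: "\<bar>\<tau> s - \<tau>' s\<bar> \<le> (\<Sum>s\<in>UNIV. \<bar>\<tau> s - \<tau>' s :: real\<bar>)" for \<tau> \<tau>' :: "'s \<Rightarrow> real" and s
    by (rule member_le_sum) auto
  have "related (\<lambda>(b, b', \<tau>, \<tau>', Z, Z'). priority_passes C1 C0 C2 ss b \<tau> Z)
                (\<lambda>(b, b', \<tau>, \<tau>', Z, Z'). priority_passes C1 C0 C2 ss b' \<tau>' Z')"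
    unfolding case_prod_beta
  proof (rule related_priority_passes)
    show "Q (\<lambda>i. fst i) (\<lambda>i. fst (snd i))"
      unfolding Q_def
      by (rule exI[of _ 1]) (auto simp: d_def intro!: add_increasing2 sum_nonneg)
  next
    fix s
    show "Q (\<lambda>i. fst (snd (snd i)) s) (\<lambda>i. fst (snd (snd (snd i))) s)"
      unfolding Q_def
      by (rule exI[of _ 1])
         (clarsimp simp: d_def, rule add_increasing2, simp add: sum_nonneg, rule add_increasing,
          simp, rule coord)
  next
    fix s
    show "Q (\<lambda>i. fst (snd (snd (snd (snd i)))) s) (\<lambda>i. snd (snd (snd (snd (snd i)))) s)"
      unfolding Q_def
      by (rule exI[of _ 1])
         (auto simp: d_def intro!: add_increasing coord sum_nonneg)
  qed
  then have "\<forall>s. \<exists>K\<ge>0. \<forall>i.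
      \<bar>snd (case i of (b, b', \<tau>, \<tau>', Z, Z') \<Rightarrow> priority_passes C1 C0 C2 ss b \<tau> Z) s
       - snd (case i of (b, b', \<tau>, \<tau>', Z, Z') \<Rightarrow> priority_passes C1 C0 C2 ss b' \<tau>' Z') s\<bar>
      \<le> K * d i"
    unfolding related_def by (simp add: Q_def)
  then have "\<forall>s. \<exists>K\<ge>0. \<forall>b b' \<tau> \<tau>' Z Z'.
    \<bar>snd (priority_passes C1 C0 C2 ss b \<tau> Z) s - snd (priority_passes C1 C0 C2 ss b' \<tau>' Z') s\<bar>
      \<le> K * d (b, b', \<tau>, \<tau>', Z, Z')"
    by fastforce
  then obtain K where K: "\<And>s. K s \<ge> 0"
    "\<And>s b b' \<tau> \<tau>' Z Z'.
      \<bar>snd (priority_passes C1 C0 C2 ss b \<tau> Z) s - snd (priority_passes C1 C0 C2 ss b' \<tau>' Z') s\<bar>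
      \<le> K s * d (b, b', \<tau>, \<tau>', Z, Z')"
    by metis
  have "K s \<le> sum K UNIV" for s
    using K(1) by (intro member_le_sum) auto
  then have "\<bar>snd (priority_passes C1 C0 C2 ss b \<tau> Z) s - snd (priority_passes C1 C0 C2 ss b' \<tau>' Z') s\<bar>
      \<le> sum K UNIV * d (b, b', \<tau>, \<tau>', Z, Z')" for s b b' \<tau> \<tau>' Z Z'
    by (meson K(2) d_nonneg mult_right_mono order_trans)
  moreover have "sum K UNIV \<ge> 0" by (simp add: K(1) sum_nonneg)
  ultimately show ?thesis unfolding d_def by auto
qed

text \<open>
  When the leading coefficients differ, the gap between the two sequences is of order \<open>N\<close>, which
  beats both fluctuations of order \<open>sqrt N\<close>: the minimum is eventually the sequence with the
  smaller coefficient.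
\<close>

lemma expansion_min:
  fixes F :: "nat filter"
  assumes F: "F \<le> sequentially"
    and A: "((\<lambda>N. (A N - real N * c) / sqrt (real N)) \<longlongrightarrow> l) F"
    and B: "((\<lambda>N. (B N - real N * c') / sqrt (real N)) \<longlongrightarrow> l') F"
    and less: "c < c'"
  shows "((\<lambda>N. (min (A N) (B N) - real N * min c c') / sqrt (real N)) \<longlongrightarrow> l) F"
proof -
  have sqrt_top: "filterlim (\<lambda>N. sqrt (real N)) at_top F"
    by (rule filterlim_mono[OF _ order_refl F])
       (rule filterlim_compose[OF sqrt_at_top filterlim_real_sequentially])
  have gt0: "eventually (\<lambda>N. N > (0::nat)) F"
    using F eventually_gt_at_top[of "0::nat"] by (auto simp: le_filter_def)
  have "filterlim (\<lambda>N. ((B N - real N * c') / sqrt (real N) - (A N - real N * c) / sqrt (real N))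
          + (c' - c) * sqrt (real N)) at_top F"
    by (intro filterlim_tendsto_add_at_top[OF tendsto_diff[OF B A]]
          filterlim_tendsto_pos_mult_at_top[OF tendsto_const _ sqrt_top]) (use less in simp)
  then have "eventually (\<lambda>N. ((B N - real N * c') / sqrt (real N) - (A N - real N * c) / sqrt (real N))
          + (c' - c) * sqrt (real N) > 0) F"
    by (simp add: filterlim_at_top_dense)
  then have "eventually (\<lambda>N. (A N - real N * c) / sqrt (real N)
      = (min (A N) (B N) - real N * min c c') / sqrt (real N)) F"
    using gt0
  proof eventually_elim
    case (elim N)
    have "(c' - c) * sqrt (real N) = (c' - c) * real N / sqrt (real N)"
      using elim(2) by (simp add: field_simps)
    then have "(B N - A N) / sqrt (real N) > 0"
      using elim(1) by (simp add: diff_divide_distrib add_divide_distrib algebra_simps)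
    then have "A N < B N" using elim(2) by (simp add: zero_less_divide_iff)
    then show ?case using less by simp
  qed
  from Lim_transform_eventually[OF A this] show ?thesis .
qed

text \<open>
  The second family of the relation is the exact multiple \<open>N c\<close>. Running the passes on these
  multiples therefore shows which coefficient each output has. In a minimum of sequences with equal
  coefficients the corrections of order \<open>sqrt N\<close> are compared; otherwise the coefficients decide.
\<close>

lemma arithmetic_relation_expansion:
  assumes F: "F \<le> sequentially"
  shows "arithmetic_relation (\<lambda>A C. \<exists>c l. (\<forall>N. C N = real N * c) \<and>
           ((\<lambda>N. (A N - real N * c) / sqrt (real N)) \<longlongrightarrow> l) F)"
    (is "arithmetic_relation ?Q")
proof
  show "?Q (\<lambda>i. 0) (\<lambda>i. 0)"
    by (rule exI[of _ 0], rule exI[of _ 0]) simp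
next
  fix f f' g g'
  assume "?Q f f'" "?Q g g'"
  then obtain c l d m where
    c: "\<And>N. f' N = real N * c" "((\<lambda>N. (f N - real N * c) / sqrt (real N)) \<longlongrightarrow> l) F" and
    d: "\<And>N. g' N = real N * d" "((\<lambda>N. (g N - real N * d) / sqrt (real N)) \<longlongrightarrow> m) F"
    by blast
  have "((\<lambda>N. ((f N + g N) - real N * (c + d)) / sqrt (real N)) \<longlongrightarrow> l + m) F"
    using tendsto_add[OF c(2) d(2)]
    by (simp add: algebra_simps diff_divide_distrib add_divide_distrib)
  then show "?Q (\<lambda>i. f i + g i) (\<lambda>i. f' i + g' i)"
    by (intro exI[of _ "c + d"] exI[of _ "l + m"]) (simp add: c d algebra_simps)
  have "((\<lambda>N. ((f N - g N) - real N * (c - d)) / sqrt (real N)) \<longlongrightarrow> l - m) F"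
    using tendsto_diff[OF c(2) d(2)]
    by (simp add: algebra_simps diff_divide_distrib add_divide_distrib)
  then show "?Q (\<lambda>i. f i - g i) (\<lambda>i. f' i - g' i)"
    by (intro exI[of _ "c - d"] exI[of _ "l - m"]) (simp add: c d algebra_simps)
  have "\<exists>k. ((\<lambda>N. (min (f N) (g N) - real N * min c d) / sqrt (real N)) \<longlongrightarrow> k) F"
  proof (cases c d rule: linorder_cases)
    case less
    then show ?thesis using expansion_min[OF F c(2) d(2)] by blast
  next
    case greater
    then show ?thesis using expansion_min[OF F d(2) c(2)] by (auto simp: min.commute)
  next
    case equal
    have "((\<lambda>N. min ((f N - real N * c) / sqrt (real N)) ((g N - real N * d) / sqrt (real N)))
            \<longlongrightarrow> min l m) F"
      by (rule tendsto_min[OF c(2) d(2)])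
    moreover have "min ((f N - real N * c) / sqrt (real N)) ((g N - real N * d) / sqrt (real N))
        = (min (f N) (g N) - real N * min c d) / sqrt (real N)" for N
      unfolding equal
      by (cases "f N \<le> g N") (auto simp: min_def divide_right_mono divide_le_cancel)
    ultimately show ?thesis by auto
  qed
  then obtain k where
    "((\<lambda>N. (min (f N) (g N) - real N * min c d) / sqrt (real N)) \<longlongrightarrow> k) F" by blast
  then show "?Q (\<lambda>i. min (f i) (g i)) (\<lambda>i. min (f' i) (g' i))"
    by (intro exI[of _ "min c d"] exI[of _ k]) (simp add: c d min_mult_distrib_left)
qed

lemma priority_passes_expansion:
  fixes F :: "nat filter"
  assumes F: "F \<le> sequentially"
    and b: "((\<lambda>N. (b N - real N * b\<^sub>0) / sqrt (real N)) \<longlongrightarrow> lb) F"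
    and \<tau>: "\<And>s. ((\<lambda>N. (\<tau> N s - real N * \<tau>\<^sub>0 s) / sqrt (real N)) \<longlongrightarrow> l\<tau> s) F"
    and Z: "\<And>s. ((\<lambda>N. (Z N s - real N * Z\<^sub>0 s) / sqrt (real N)) \<longlongrightarrow> lZ s) F"
  shows "\<exists>l. ((\<lambda>N. (snd (priority_passes C1 C0 C2 ss (b N) (\<tau> N) (Z N)) s
     - snd (priority_passes C1 C0 C2 ss (real N * b\<^sub>0) (\<lambda>s. real N * \<tau>\<^sub>0 s) (\<lambda>s. real N * Z\<^sub>0 s)) s)
     / sqrt (real N)) \<longlongrightarrow> l) F"
proof -
  interpret arithmetic_relation "\<lambda>A C. \<exists>c l. (\<forall>N. C N = real N * c) \<and>
           ((\<lambda>N. (A N - real N * c) / sqrt (real N)) \<longlongrightarrow> l) F"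
    by (rule arithmetic_relation_expansion[OF F])
  have "related (\<lambda>N. priority_passes C1 C0 C2 ss (b N) (\<tau> N) (Z N))
     (\<lambda>N. priority_passes C1 C0 C2 ss (real N * b\<^sub>0) (\<lambda>s. real N * \<tau>\<^sub>0 s) (\<lambda>s. real N * Z\<^sub>0 s))"
  proof (rule related_priority_passes)
    show "\<exists>c l. (\<forall>N. real N * b\<^sub>0 = real N * c) \<and>
        ((\<lambda>N. (b N - real N * c) / sqrt (real N)) \<longlongrightarrow> l) F"
      using b by (intro exI[of _ b\<^sub>0] exI[of _ lb]) simp
    show "\<exists>c l. (\<forall>N. real N * \<tau>\<^sub>0 s = real N * c) \<and>
        ((\<lambda>N. (\<tau> N s - real N * c) / sqrt (real N)) \<longlongrightarrow> l) F" for s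
      using \<tau>[of s] by (intro exI[of _ "\<tau>\<^sub>0 s"] exI[of _ "l\<tau> s"]) simp
    show "\<exists>c l. (\<forall>N. real N * Z\<^sub>0 s = real N * c) \<and>
        ((\<lambda>N. (Z N s - real N * c) / sqrt (real N)) \<longlongrightarrow> l) F" for s
      using Z[of s] by (intro exI[of _ "Z\<^sub>0 s"] exI[of _ "lZ s"]) simp
  qed
  then show ?thesis unfolding related_def by (elim conjE allE[where x = s]) force
qed

section \<open>The passes on the fluid input\<close>

text \<open>
  With nonnegative demands whose total is covered by the budget, the budget never binds in the
  minimum.
\<close>

lemma fold_pull_target:
  assumes "distinct xs" "\<And>s. s \<in> set xs \<Longrightarrow> min (Z s) (\<tau> s) \<ge> 0"
    "(\<Sum>s\<in>set xs. min (Z s) (\<tau> s)) \<le> B"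
  shows "fold (pull_target \<tau> Z) xs (B, Y) =
    (B - (\<Sum>s\<in>set xs. min (Z s) (\<tau> s)), \<lambda>s. if s \<in> set xs then min (Z s) (\<tau> s) else Y s)"
  using assms
proof (induction xs arbitrary: B Y)
  case (Cons s xs)
  have "0 \<le> (\<Sum>s\<in>set xs. min (Z s) (\<tau> s))"
    using Cons.prems by (intro sum_nonneg) auto
  then have "min B (min (Z s) (\<tau> s)) = min (Z s) (\<tau> s)"
    using Cons.prems by simp
  with Cons show ?case by (auto simp: Let_def fun_eq_iff)
qed simp

lemma pull_all_eq_pull_target: "pull_all Z = pull_target Z Z"
  by (auto simp: fun_eq_iff Let_def)

lemma fold_pull_all:
  assumes "distinct xs" "\<And>s. s \<in> set xs \<Longrightarrow> Z s \<ge> 0" "(\<Sum>s\<in>set xs. Z s) \<le> B"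
  shows "fold (pull_all Z) xs (B, Y) =
    (B - (\<Sum>s\<in>set xs. Z s), \<lambda>s. if s \<in> set xs then Z s else Y s)"
  using fold_pull_target[of xs Z Z B Y] assms by (simp add: pull_all_eq_pull_target cong: if_cong)

lemma fold_pull_rest_no_budget:
  assumes "\<And>s. Y s \<le> Z s"
  shows "fold (pull_rest Z) xs (0, Y) = (0, Y)"
proof (induction xs)
  case (Cons s xs)
  then show ?case using assms[of s] by (simp add: Let_def)
qed simp

lemma fold_pull_all_no_budget:
  assumes "\<And>s. 0 \<le> Z s" "\<And>s. s \<in> set xs \<Longrightarrow> Y s = 0"
  shows "fold (pull_all Z) xs (0, Y) = (0, Y)"
  using assms(2)
proof (induction xs)
  case (Cons s xs)
  then have "Y(s := 0) = Y" by auto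
  then show ?case using Cons assms(1)[of s] by (simp add: Let_def)
qed simp

text \<open>
  Here \<open>u\<close> is the pulled and \<open>w\<close> the idle part of the fluid state. Active states are pulled
  completely and neutral states up to their target; this uses up the budget exactly, so the last
  two passes change nothing.
\<close>

lemma priority_passes_fluid:
  fixes u w :: "'s::finite \<Rightarrow> real"
  assumes ss: "distinct ss" "set ss = UNIV"
    and nonneg: "\<And>s. 0 \<le> u s" "\<And>s. 0 \<le> w s"
    and budget: "sum u UNIV = b"
    and C1: "\<And>s. s \<in> C1 \<Longrightarrow> w s = 0" and C2: "\<And>s. s \<in> C2 \<Longrightarrow> u s = 0"
    and disj: "C1 \<inter> C0 = {}" and cover: "C1 \<union> C0 \<union> C2 = UNIV"
  shows "snd (priority_passes C1 C0 C2 ss b u (\<lambda>s. u s + w s)) = u"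
proof -
  have b_split: "b = sum u C1 + sum u C0"
  proof -
    have "sum u UNIV = sum u (C1 \<union> C0)"
      by (rule sum.mono_neutral_right) (use cover C2 in auto)
    then show ?thesis using budget disj by (simp add: sum.union_disjoint)
  qed
  let ?Y1 = "\<lambda>s. if s \<in> C1 then u s else 0"
  have C1_eq: "(\<Sum>s\<in>C1. u s + w s) = sum u C1" using C1 by (intro sum.cong) auto
  have pass1: "fold (pull_all (\<lambda>s. u s + w s)) (filter (\<lambda>s. s \<in> C1) ss) (b, \<lambda>s. 0) = (sum u C0, ?Y1)"
    using ss nonneg b_split C1
    by (subst fold_pull_all) (auto simp: C1_eq sum_nonneg fun_eq_iff)
  have min_eq: "min (u s + w s) (u s) = u s" for s using nonneg[of s] by simp
  have pass2: "fold (pull_target u (\<lambda>s. u s + w s)) (filter (\<lambda>s. s \<in> C0) ss) (sum u C0, ?Y1) = (0, u)"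
    using ss nonneg disj cover C2
    by (subst fold_pull_target) (auto simp: min_eq fun_eq_iff)
  show ?thesis
    unfolding priority_passes_def pass1 pass2
    by (subst fold_pull_rest_no_budget, use nonneg in simp,
        subst fold_pull_all_no_budget) (use nonneg C2 in \<open>auto intro: add_nonneg_nonneg\<close>)
qed

section \<open>Integrality and exhaustion of the budget\<close>

text \<open>
  The set \<open>U\<close> holds states not yet visited: the passes that overwrite a pull count conserve the
  total only if the old count is 0. The set \<open>D\<close> holds states that are done, having been served
  until they or the budget were exhausted.
\<close>

definition pulls_invariant ::
  "real \<Rightarrow> ('s::finite \<Rightarrow> real) \<Rightarrow> 's set \<Rightarrow> 's set \<Rightarrow> real \<times> ('s \<Rightarrow> real) \<Rightarrow> bool" where
  "pulls_invariant b Z U D st \<longleftrightarrow>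
     fst st \<in> \<nat> \<and> (\<forall>s. snd st s \<in> \<nat> \<and> snd st s \<le> Z s) \<and> fst st + sum (snd st) UNIV = b \<and>
     (\<forall>s\<in>U. snd st s = 0) \<and> (\<forall>s\<in>D. fst st = 0 \<or> snd st s = Z s)"

lemma sum_fun_upd_add: "sum (f(s := f s + m)) UNIV = sum f UNIV + (m::real)"
  for f :: "'s::finite \<Rightarrow> real"
  by (subst (1 2) sum.remove[of UNIV s]) (auto intro!: sum.cong)

text \<open>
  All three kinds of pass move an amount \<open>m\<close> from the budget to one state. A state that was already done
  stays done, because an exhausted budget forces \<open>m = 0\<close>. The set \<open>D'\<close> is a parameter because
  serving \<open>s\<close> finishes it in the passes without targets, but not in the pass that stops at the
  target.
\<close>

lemma pulls_invariant_pull: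
  assumes inv: "pulls_invariant b Z U D (B, Y)"
    and m: "m \<in> \<nat>" "m \<le> B" "m \<le> Z s - Y s"
    and D': "D' \<subseteq> insert s D" "s \<in> D' \<Longrightarrow> m = B \<or> m = Z s - Y s"
  shows "pulls_invariant b Z (U - {s}) D' (B - m, Y(s := Y s + m))"
proof -
  have m0: "m \<ge> 0" using m(1) by (auto elim: Nats_cases)
  have B: "B \<in> \<nat>" "Y s \<in> \<nat>" "\<And>s. Y s \<le> Z s" "\<And>s. Y s \<in> \<nat>" "B + sum Y UNIV = b"
    and U: "\<And>s. s \<in> U \<Longrightarrow> Y s = 0" and D: "\<And>s. s \<in> D \<Longrightarrow> B = 0 \<or> Y s = Z s"
    using inv by (auto simp: pulls_invariant_def)
  show ?thesis
    unfolding pulls_invariant_def fst_conv snd_conv sum_fun_upd_add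
  proof (intro conjI allI ballI)
    show "B - m \<in> \<nat>" using B m by (intro Nats_diff) auto
    show "(Y(s := Y s + m)) s' \<in> \<nat>" for s' using B m by auto
    show "(Y(s := Y s + m)) s' \<le> Z s'" for s' using B m by auto
    show "B - m + (sum Y UNIV + m) = b" using B by simp
    show "(Y(s := Y s + m)) s' = 0" if "s' \<in> U - {s}" for s' using that U by simp
    show "B - m = 0 \<or> (Y(s := Y s + m)) s' = Z s'" if "s' \<in> D'" for s'
    proof (cases "s' = s")
      case True
      then show ?thesis using that D' by auto
    next
      case False
      then have "s' \<in> D" using that D' by auto
      then show ?thesis using D[of s'] False m m0 by auto
    qed
  qed
qed

lemma pulls_invariant_pull_all:
  assumes "pulls_invariant b Z U D st" "s \<in> U" "\<And>s. Z s \<in> \<nat>"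
  shows "pulls_invariant b Z (U - {s}) (insert s D) (pull_all Z s st)"
proof -
  obtain B Y where st: "st = (B, Y)" by (cases st)
  have "Y s = 0" "B \<in> \<nat>" using assms unfolding pulls_invariant_def st by auto
  then have "pulls_invariant b Z (U - {s}) (insert s D)
      (B - min B (Z s), Y(s := Y s + min B (Z s)))"
    using assms unfolding st
    by (intro pulls_invariant_pull) (auto simp: min_def)
  then show ?thesis using \<open>Y s = 0\<close> by (simp add: st Let_def)
qed

lemma pulls_invariant_pull_rest:
  assumes "pulls_invariant b Z U D st" "\<And>s. Z s \<in> \<nat>"
  shows "pulls_invariant b Z (U - {s}) (insert s D) (pull_rest Z s st)"
proof -
  obtain B Y where st: "st = (B, Y)" by (cases st)
  have "B \<in> \<nat>" "Y s \<in> \<nat>" "Y s \<le> Z s" using assms unfolding pulls_invariant_def st by auto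
  then have "pulls_invariant b Z (U - {s}) (insert s D)
      (B - min B (Z s - Y s), Y(s := Y s + min B (Z s - Y s)))"
    using assms unfolding st
    by (intro pulls_invariant_pull) (auto simp: min_def)
  then show ?thesis by (simp add: st Let_def)
qed

lemma pulls_invariant_pull_target:
  assumes "pulls_invariant b Z U D st" "s \<in> U" "\<And>s. Z s \<in> \<nat>" "\<And>s. \<tau> s \<in> \<nat>"
  shows "pulls_invariant b Z (U - {s}) (D - {s}) (pull_target \<tau> Z s st)"
proof -
  obtain B Y where st: "st = (B, Y)" by (cases st)
  have "Y s = 0" "B \<in> \<nat>" using assms unfolding pulls_invariant_def st by auto
  then have "pulls_invariant b Z (U - {s}) (D - {s})
      (B - min B (min (Z s) (\<tau> s)), Y(s := Y s + min B (min (Z s) (\<tau> s))))"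
    using assms unfolding st
    by (intro pulls_invariant_pull) (auto simp: min_def)
  then show ?thesis using \<open>Y s = 0\<close> by (simp add: st Let_def)
qed

lemma pulls_invariant_mono:
  "pulls_invariant b Z U D st \<Longrightarrow> U' \<subseteq> U \<Longrightarrow> D' \<subseteq> D \<Longrightarrow> pulls_invariant b Z U' D' st"
  by (auto simp: pulls_invariant_def)

lemma pulls_invariant_fold_pull_all:
  assumes "distinct xs" "pulls_invariant b Z U D st" "set xs \<subseteq> U" "\<And>s. Z s \<in> \<nat>"
  shows "pulls_invariant b Z (U - set xs) (D \<union> set xs) (fold (pull_all Z) xs st)"
  using assms
proof (induction xs arbitrary: U D st)
  case (Cons s xs)
  have "pulls_invariant b Z (U - {s} - set xs) (insert s D \<union> set xs)
          (fold (pull_all Z) xs (pull_all Z s st))"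
    by (rule Cons.IH) (use Cons.prems pulls_invariant_pull_all[of b Z U D st s] in auto)
  then show ?case by (auto elim!: pulls_invariant_mono)
qed simp

lemma pulls_invariant_fold_pull_rest:
  assumes "pulls_invariant b Z U D st" "\<And>s. Z s \<in> \<nat>"
  shows "pulls_invariant b Z (U - set xs) (D \<union> set xs) (fold (pull_rest Z) xs st)"
  using assms
proof (induction xs arbitrary: U D st)
  case (Cons s xs)
  have "pulls_invariant b Z (U - {s} - set xs) (insert s D \<union> set xs)
          (fold (pull_rest Z) xs (pull_rest Z s st))"
    by (rule Cons.IH) (use Cons.prems pulls_invariant_pull_rest[of b Z U D st s] in auto)
  then show ?case by (auto elim!: pulls_invariant_mono)
qed simp

lemma pulls_invariant_fold_pull_target:
  assumes "distinct xs" "pulls_invariant b Z U D st" "set xs \<subseteq> U" "\<And>s. Z s \<in> \<nat>" "\<And>s. \<tau> s \<in> \<nat>"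
  shows "pulls_invariant b Z (U - set xs) (D - set xs) (fold (pull_target \<tau> Z) xs st)"
  using assms
proof (induction xs arbitrary: U D st)
  case (Cons s xs)
  have "pulls_invariant b Z (U - {s} - set xs) (D - {s} - set xs)
          (fold (pull_target \<tau> Z) xs (pull_target \<tau> Z s st))"
    by (rule Cons.IH) (use Cons.prems pulls_invariant_pull_target[of b Z U D st s \<tau>] in auto)
  then show ?case by (auto elim!: pulls_invariant_mono)
qed simp

text \<open>
  At the end every state is done. Were some budget left, all states would be pulled completely,
  so the pulls would total \<open>sum Z UNIV\<close>, which is no less than the whole budget \<open>b\<close>.
\<close>

lemma priority_passes_feasible:
  fixes Z :: "'s::finite \<Rightarrow> real"
  assumes ss: "distinct ss" "set ss = UNIV"
    and nat: "\<And>s. Z s \<in> \<nat>" "\<And>s. \<tau> s \<in> \<nat>" "b \<in> \<nat>"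
    and b: "b \<le> sum Z UNIV"
    and disj: "C1 \<inter> C0 = {}" "C1 \<inter> C2 = {}" "C0 \<inter> C2 = {}" and cover: "C1 \<union> C0 \<union> C2 = UNIV"
  defines "Y \<equiv> snd (priority_passes C1 C0 C2 ss b \<tau> Z)"
  shows "Y s \<in> \<nat>" "Y s \<le> Z s" "sum Y UNIV = b"
proof -
  let ?st1 = "fold (pull_all Z) (filter (\<lambda>s. s \<in> C1) ss) (b, \<lambda>s. 0)"
  let ?st2 = "fold (pull_target \<tau> Z) (filter (\<lambda>s. s \<in> C0) ss) ?st1"
  let ?st3 = "fold (pull_rest Z) (filter (\<lambda>s. s \<in> C0) ss) ?st2"
  let ?st4 = "fold (pull_all Z) (filter (\<lambda>s. s \<in> C2) ss) ?st3"
  have Z0: "0 \<le> Z s" for s using nat(1)[of s] by (auto elim: Nats_cases)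
  have "pulls_invariant b Z UNIV {} (b, \<lambda>s. 0)"
    using nat Z0 by (auto simp: pulls_invariant_def)
  then have "pulls_invariant b Z (UNIV - C1) ({} \<union> C1) ?st1"
    using pulls_invariant_fold_pull_all[of "filter (\<lambda>s. s \<in> C1) ss" b Z UNIV "{}"] ss nat by auto
  then have "pulls_invariant b Z (UNIV - C1 - C0) ({} \<union> C1 - C0) ?st2"
    using pulls_invariant_fold_pull_target[of "filter (\<lambda>s. s \<in> C0) ss" b Z "UNIV - C1" C1 ?st1 \<tau>]
      ss nat disj by (auto simp: disjoint_iff subset_iff)
  then have "pulls_invariant b Z (UNIV - C1 - C0 - C0) (({} \<union> C1 - C0) \<union> C0) ?st3"
    using pulls_invariant_fold_pull_rest[of b Z "UNIV - C1 - C0" "C1 - C0" ?st2 "filter (\<lambda>s. s \<in> C0) ss"] ss nat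
    by auto
  then have "pulls_invariant b Z C2 (C1 \<union> C0) ?st3"
    by (rule pulls_invariant_mono) (use disj cover in auto)
  then have "pulls_invariant b Z (C2 - C2) ((C1 \<union> C0) \<union> C2) ?st4"
    using pulls_invariant_fold_pull_all[of "filter (\<lambda>s. s \<in> C2) ss" b Z "C2" _ ?st3] ss nat by auto
  then have inv: "pulls_invariant b Z {} UNIV (priority_passes C1 C0 C2 ss b \<tau> Z)"
    by (simp add: priority_passes_def cover)
  show "Y s \<in> \<nat>" "Y s \<le> Z s" using inv unfolding pulls_invariant_def Y_def by auto
  define B where "B = fst (priority_passes C1 C0 C2 ss b \<tau> Z)"
  have B: "B \<in> \<nat>" "B + sum Y UNIV = b" "\<And>s. B = 0 \<or> Y s = Z s"
    using inv unfolding pulls_invariant_def Y_def B_def by auto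
  have "B = 0"
  proof (rule ccontr)
    assume "B \<noteq> 0"
    then have "Y = Z" using B(3) by auto
    then have "B \<le> 0" using B(2) b by simp
    moreover have "B \<ge> 0" using B(1) by (auto elim: Nats_cases)
    ultimately show False using \<open>B \<noteq> 0\<close> by simp
  qed
  then show "sum Y UNIV = b" using B(2) by simp
qed

section \<open>Diffusion regularity\<close>

lemma fluid_state_eq: "fluid_state x t s = x t s True + x t s False"
  by (simp add: fluid_state_def UNIV_bool)

lemma to_infinity_le_sequentially: "to_infinity T \<alpha> \<le> sequentially"
  by (simp add: to_infinity_def)

lemma eventually_to_infinity: "(\<And>N. N \<in> arm_numbers T \<alpha> \<Longrightarrow> R N) \<Longrightarrow> eventually R (to_infinity T \<alpha>)"
  by (simp add: to_infinity_def eventually_inf_principal)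

locale fluid_priority_setting =
  fixes T :: nat
    and p :: "nat \<Rightarrow> 's::finite \<Rightarrow> bool \<Rightarrow> 's pmf"
    and \<alpha> :: "nat \<Rightarrow> real"
    and s0 :: 's
    and x :: "'s occupation"
    and P :: "nat \<Rightarrow> 's \<Rightarrow> real"
    and ord :: "nat \<Rightarrow> 's list"
  assumes budget_ratio: "t \<in> {1..T} \<Longrightarrow> 0 \<le> \<alpha> t \<and> \<alpha> t \<le> 1"
    and occ: "occupation_measure T p \<alpha> s0 x"
    and order: "t \<in> {1..T} \<Longrightarrow> priority_order (P t) (ord t)"
begin

abbreviation pulls where "pulls \<equiv> fluid_priority_pulls \<alpha> x ord"

abbreviation policy where "policy \<equiv> fluid_priority_policy \<alpha> x ord"

lemma states_partition:
  assumes "t \<in> {1..T}"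
  shows "fluid_active x t \<union> fluid_neutral x t \<union> fluid_inactive x t = UNIV"
    and "fluid_active x t \<inter> fluid_neutral x t = {}"
    and "fluid_active x t \<inter> fluid_inactive x t = {}"
    and "fluid_neutral x t \<inter> fluid_inactive x t = {}"
proof -
  have "x t s a \<ge> 0" for s a
    using occ assms by (auto simp: occupation_measure_def)
  then show "fluid_active x t \<union> fluid_neutral x t \<union> fluid_inactive x t = UNIV"
    by (auto simp: fluid_active_def fluid_neutral_def fluid_inactive_def less_le)
qed (auto simp: fluid_active_def fluid_neutral_def fluid_inactive_def)

text \<open>
  The factor \<open>c\<close> is needed at \<open>c = N\<close>, for the comparison with \<open>N\<close> arms.
\<close>

lemma priority_passes_occupation:
  assumes t: "t \<in> {1..T}" and c: "c \<ge> 0"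
  shows "snd (priority_passes (fluid_active x t) (fluid_neutral x t) (fluid_inactive x t) (ord t)
      (c * \<alpha> t) (\<lambda>s. c * x t s True) (\<lambda>s. c * fluid_state x t s)) = (\<lambda>s. c * x t s True)"
proof -
  have nonneg: "x t s a \<ge> 0" for s a
    using occ t by (auto simp: occupation_measure_def)
  have "(\<Sum>s\<in>UNIV. x t s True) = \<alpha> t"
    using occ t by (auto simp: occupation_measure_def)
  then have "(\<Sum>s\<in>UNIV. c * x t s True) = c * \<alpha> t"
    by (simp flip: sum_distrib_left)
  then show ?thesis
    using nonneg order[OF t] c states_partition[OF t] unfolding fluid_state_eq distrib_left
    by (intro priority_passes_fluid)
       (auto simp: fluid_active_def fluid_neutral_def fluid_inactive_def priority_order_def)
qed

lemma pulls_lipschitz: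
  shows "\<exists>K\<ge>0. \<forall>t\<in>{1..T}. \<forall>N Z Z' s.
    \<bar>pulls N t Z s - pulls N t Z' s\<bar>
      \<le> K * (\<Sum>s\<in>UNIV. \<bar>Z s - Z' s\<bar>)"
proof -
  have "\<exists>K\<ge>0. \<forall>N Z Z' s.
    \<bar>pulls N t Z s - pulls N t Z' s\<bar>
      \<le> K * (\<Sum>s\<in>UNIV. \<bar>Z s - Z' s\<bar>)" for t
  proof -
    obtain K where "K \<ge> 0" and K: "\<And>b b' \<tau> \<tau>' Z Z' s.
      \<bar>snd (priority_passes (fluid_active x t) (fluid_neutral x t) (fluid_inactive x t) (ord t) b \<tau> Z) s
       - snd (priority_passes (fluid_active x t) (fluid_neutral x t) (fluid_inactive x t) (ord t) b' \<tau>' Z') s\<bar>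
      \<le> K * (\<bar>b - b'\<bar> + (\<Sum>s\<in>UNIV. \<bar>\<tau> s - \<tau>' s\<bar>) + (\<Sum>s\<in>UNIV. \<bar>Z s - Z' s\<bar>))"
      using priority_passes_lipschitz[of "fluid_active x t" "fluid_neutral x t" "fluid_inactive x t" "ord t"]
      by blast
    have "\<bar>pulls N t Z s - pulls N t Z' s\<bar>
      \<le> K * (\<Sum>s\<in>UNIV. \<bar>Z s - Z' s\<bar>)" for N Z Z' s
      using K[of "\<alpha> t * real N" "\<lambda>s. of_int \<lfloor>real N * x t s True\<rfloor>" Z s
          "\<alpha> t * real N" "\<lambda>s. of_int \<lfloor>real N * x t s True\<rfloor>" Z']
      by (simp add: fluid_priority_pulls_eq_passes)
    with \<open>K \<ge> 0\<close> show ?thesis by blast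
  qed
  then obtain K where K: "\<And>t. K t \<ge> 0" "\<And>t N Z Z' s.
    \<bar>pulls N t Z s - pulls N t Z' s\<bar>
      \<le> K t * (\<Sum>s\<in>UNIV. \<bar>Z s - Z' s\<bar>)"
    by metis
  have "\<bar>pulls N t Z s - pulls N t Z' s\<bar>
      \<le> sum K {1..T} * (\<Sum>s\<in>UNIV. \<bar>Z s - Z' s\<bar>)" if "t \<in> {1..T}" for t N Z Z' s
  proof -
    have "K t \<le> sum K {1..T}" using that K(1) by (intro member_le_sum) auto
    then have "K t * (\<Sum>s\<in>UNIV. \<bar>Z s - Z' s\<bar>) \<le> sum K {1..T} * (\<Sum>s\<in>UNIV. \<bar>Z s - Z' s\<bar>)"
      by (intro mult_right_mono sum_nonneg) auto
    with K(2) show ?thesis by (rule order_trans)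
  qed
  moreover have "sum K {1..T} \<ge> 0" by (simp add: K(1) sum_nonneg)
  ultimately show ?thesis by blast
qed

text \<open>
  On the exact fluid state the only deviation from \<open>N x\<close> comes from rounding down the targets. Each
  of them moves by at most 1, so the output moves by a bounded amount.
\<close>

lemma pulls_at_fluid:
  shows "\<exists>K\<ge>0. \<forall>t\<in>{1..T}. \<forall>N s.
    \<bar>pulls N t (\<lambda>s. real N * fluid_state x t s) s - real N * x t s True\<bar> \<le> K"
proof -
  have "\<exists>K\<ge>0. \<forall>N s.
    \<bar>pulls N t (\<lambda>s. real N * fluid_state x t s) s - real N * x t s True\<bar> \<le> K"
    if t: "t \<in> {1..T}" for t
  proof -
    obtain K where "K \<ge> 0" and K: "\<And>b b' \<tau> \<tau>' Z Z' s.
      \<bar>snd (priority_passes (fluid_active x t) (fluid_neutral x t) (fluid_inactive x t) (ord t) b \<tau> Z) s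
       - snd (priority_passes (fluid_active x t) (fluid_neutral x t) (fluid_inactive x t) (ord t) b' \<tau>' Z') s\<bar>
      \<le> K * (\<bar>b - b'\<bar> + (\<Sum>s\<in>UNIV. \<bar>\<tau> s - \<tau>' s\<bar>) + (\<Sum>s\<in>UNIV. \<bar>Z s - Z' s\<bar>))"
      using priority_passes_lipschitz[of "fluid_active x t" "fluid_neutral x t" "fluid_inactive x t" "ord t"]
      by blast
    have "\<bar>pulls N t (\<lambda>s. real N * fluid_state x t s) s - real N * x t s True\<bar>
        \<le> K * real CARD('s)" for N s
    proof -
      have "snd (priority_passes (fluid_active x t) (fluid_neutral x t) (fluid_inactive x t) (ord t)
          (real N * \<alpha> t) (\<lambda>s. real N * x t s True) (\<lambda>s. real N * fluid_state x t s)) s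
          = real N * x t s True"
        by (subst priority_passes_occupation[OF t]) auto
      then have "\<bar>pulls N t (\<lambda>s. real N * fluid_state x t s) s - real N * x t s True\<bar>
          \<le> K * (\<Sum>s\<in>UNIV. \<bar>of_int \<lfloor>real N * x t s True\<rfloor> - real N * x t s True\<bar>)"
        using K[of "\<alpha> t * real N" "\<lambda>s. of_int \<lfloor>real N * x t s True\<rfloor>" "\<lambda>s. real N * fluid_state x t s" s
          "real N * \<alpha> t" "\<lambda>s. real N * x t s True" "\<lambda>s. real N * fluid_state x t s"]
        by (simp add: fluid_priority_pulls_eq_passes mult.commute)
      also have "\<dots> \<le> K * (\<Sum>s\<in>(UNIV::'s set). 1)"
      proof (intro mult_left_mono sum_mono \<open>K \<ge> 0\<close>)
        show "\<bar>of_int \<lfloor>real N * x t s True\<rfloor> - real N * x t s True\<bar> \<le> 1" for s by linarith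
      qed
      finally show ?thesis by simp
    qed
    moreover have "K * real CARD('s) \<ge> 0" using \<open>K \<ge> 0\<close> by simp
    ultimately show ?thesis by blast
  qed
  then have "\<forall>t\<in>{1..T}. \<exists>K. K \<ge> 0 \<and> (\<forall>N s.
    \<bar>pulls N t (\<lambda>s. real N * fluid_state x t s) s - real N * x t s True\<bar> \<le> K)"
    by blast
  from bchoice[OF this] obtain K where K: "\<And>t. t \<in> {1..T} \<Longrightarrow> K t \<ge> 0"
    "\<And>t N s. t \<in> {1..T} \<Longrightarrow>
       \<bar>pulls N t (\<lambda>s. real N * fluid_state x t s) s - real N * x t s True\<bar> \<le> K t"
    by blast
  have "K t \<le> sum K {1..T}" if "t \<in> {1..T}" for t
    using that K(1) by (intro member_le_sum) auto
  moreover have "sum K {1..T} \<ge> 0" using K(1) by (rule sum_nonneg)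
  ultimately show ?thesis
    using K(2) by (intro exI[of _ "sum K {1..T}"]) (meson order_trans)
qed

lemma policy_lipschitz:
  shows "\<exists>K\<ge>0. \<forall>t\<in>{1..T}. \<forall>N Z Z' s a.
    \<bar>policy N t Z s a - policy N t Z' s a\<bar>
      \<le> K * (\<Sum>s\<in>UNIV. \<bar>Z s - Z' s\<bar>)"
proof -
  obtain K where K: "K \<ge> 0" "\<And>t N Z Z' s. t \<in> {1..T} \<Longrightarrow>
    \<bar>pulls N t Z s - pulls N t Z' s\<bar>
      \<le> K * (\<Sum>s\<in>UNIV. \<bar>Z s - Z' s\<bar>)"
    using pulls_lipschitz by metis
  have "\<bar>policy N t Z s a - policy N t Z' s a\<bar>
      \<le> (K + 1) * (\<Sum>s\<in>UNIV. \<bar>Z s - Z' s\<bar>)" if "t \<in> {1..T}" for t N Z Z' s a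
  proof -
    have "\<bar>Z s - Z' s\<bar> \<le> (\<Sum>s\<in>UNIV. \<bar>Z s - Z' s\<bar>)" by (rule member_le_sum) auto
    then show ?thesis
      using K(2)[OF that, of N Z s Z']
      by (auto simp: fluid_priority_policy_def Let_def distrib_right)
  qed
  then show ?thesis using K(1) by (intro exI[of _ "K + 1"]) auto
qed

lemma policy_at_fluid:
  shows "\<exists>K\<ge>0. \<forall>t\<in>{1..T}. \<forall>N s a.
    \<bar>policy N t (\<lambda>s. real N * fluid_state x t s) s a - real N * x t s a\<bar> \<le> K"
proof -
  obtain K where K: "K \<ge> 0" "\<And>t N s. t \<in> {1..T} \<Longrightarrow>
    \<bar>pulls N t (\<lambda>s. real N * fluid_state x t s) s - real N * x t s True\<bar> \<le> K"
    using pulls_at_fluid by metis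
  have "\<bar>policy N t (\<lambda>s. real N * fluid_state x t s) s a - real N * x t s a\<bar> \<le> K"
    if "t \<in> {1..T}" for t N s a
    using K(2)[OF that, of N s]
    by (cases a) (auto simp: fluid_priority_policy_def Let_def fluid_state_eq[of x t s] distrib_left)
  then show ?thesis using K(1) by blast
qed

text \<open>
  The targets differ from \<open>N x\<close> by at most 1, which is \<open>o(sqrt N)\<close>, and the states expand as
  \<open>N z + sqrt N \<theta>\<close> by definition. The pulls then have an expansion whose leading coefficient
  is the result of the passes on the fluid input, and this is the coefficient that the diffusion
  map subtracts.
\<close>

lemma diffusion_map_tendsto:
  assumes t: "t \<in> {1..T}"
  shows "\<exists>l. ((\<lambda>N. diffusion_map policy x t N \<theta> s a) \<longlongrightarrow> l) (to_infinity T \<alpha>)"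
proof -
  let ?F = "to_infinity T \<alpha>"
  have sqrt_top: "filterlim (\<lambda>N. sqrt (real N)) at_top ?F"
    by (rule filterlim_mono[OF _ order_refl to_infinity_le_sequentially])
       (rule filterlim_compose[OF sqrt_at_top filterlim_real_sequentially])
  have pos: "eventually (\<lambda>N. N > 0) ?F"
    by (rule eventually_to_infinity) (simp add: arm_numbers_def)
  have target: "((\<lambda>N. (of_int \<lfloor>real N * x t s True\<rfloor> - real N * x t s True) / sqrt (real N)) \<longlongrightarrow> 0) ?F" for s
  proof (rule Lim_null_comparison)
    have "\<bar>of_int \<lfloor>u\<rfloor> - u :: real\<bar> \<le> 1" for u by linarith
    then show "eventually (\<lambda>N. norm ((of_int \<lfloor>real N * x t s True\<rfloor> - real N * x t s True) / sqrt (real N))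
        \<le> 1 / sqrt (real N)) ?F"
      by (intro always_eventually allI) (simp add: divide_right_mono)
    show "((\<lambda>N. 1 / sqrt (real N)) \<longlongrightarrow> 0) ?F"
      by (rule tendsto_divide_0[OF tendsto_const filterlim_at_top_imp_at_infinity[OF sqrt_top]])
  qed
  have states: "((\<lambda>N. (undiffuse x t N \<theta> s - real N * fluid_state x t s) / sqrt (real N)) \<longlongrightarrow> \<theta> s) ?F" for s
    by (rule tendsto_eventually, use pos in eventually_elim) (simp add: undiffuse_def)
  have fluid: "snd (priority_passes (fluid_active x t) (fluid_neutral x t) (fluid_inactive x t) (ord t)
      (real N * \<alpha> t) (\<lambda>s. real N * x t s True) (\<lambda>s. real N * fluid_state x t s)) s
      = real N * x t s True" for N s
    by (subst priority_passes_occupation[OF t]) auto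
  have "\<exists>l. ((\<lambda>N. (pulls N t (undiffuse x t N \<theta>) s - real N * x t s True)
      / sqrt (real N)) \<longlongrightarrow> l) ?F"
    unfolding fluid_priority_pulls_eq_passes
    by (subst fluid[symmetric], rule priority_passes_expansion[OF to_infinity_le_sequentially _ target states])
       (auto simp: mult.commute)
  then obtain l where l: "((\<lambda>N. (pulls N t (undiffuse x t N \<theta>) s
      - real N * x t s True) / sqrt (real N)) \<longlongrightarrow> l) ?F"
    by blast
  show ?thesis
  proof (cases a)
    case True
    then show ?thesis using l by (auto simp: diffusion_map_def fluid_priority_policy_def Let_def)
  next
    case False
    have "diffusion_map policy x t N \<theta> s a
        = (undiffuse x t N \<theta> s - real N * fluid_state x t s) / sqrt (real N)
        - (pulls N t (undiffuse x t N \<theta>) s - real N * x t s True) / sqrt (real N)"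
      for N
      using False
      by (simp add: diffusion_map_def fluid_priority_policy_def Let_def fluid_state_eq
          flip: diff_divide_distrib) (simp add: algebra_simps)
    then show ?thesis using tendsto_diff[OF states l] by auto
  qed
qed

lemma policy_diffusion_regular:
  shows "diffusion_regular T \<alpha> x policy"
proof -
  obtain K where K: "K \<ge> 0" "\<And>t N Z Z' s a. t \<in> {1..T} \<Longrightarrow>
    \<bar>policy N t Z s a - policy N t Z' s a\<bar> \<le> K * (\<Sum>s\<in>UNIV. \<bar>Z s - Z' s\<bar>)"
    using policy_lipschitz by metis
  obtain K' where K': "K' \<ge> 0" "\<And>t N s a. t \<in> {1..T} \<Longrightarrow>
    \<bar>policy N t (\<lambda>s. real N * fluid_state x t s) s a - real N * x t s a\<bar> \<le> K'"
    using policy_at_fluid by metis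
  have sum_const: "(\<Sum>s\<in>(UNIV::'s set). \<Sum>a\<in>(UNIV::bool set). c) = 2 * real CARD('s) * c" for c :: real
    by (simp add: card_UNIV_bool)
  have lipschitz: "(\<Sum>s\<in>UNIV. \<Sum>a\<in>UNIV. \<bar>diffusion_map policy x t N \<theta>1 s a - diffusion_map policy x t N \<theta>2 s a\<bar>)
      \<le> (2 * real CARD('s) * K + 1) * (\<Sum>s\<in>UNIV. \<bar>\<theta>1 s - \<theta>2 s\<bar>)"
    if t: "t \<in> {1..T}" and N: "N \<in> arm_numbers T \<alpha>" for t N \<theta>1 \<theta>2
  proof -
    let ?d = "\<Sum>s\<in>UNIV. \<bar>\<theta>1 s - \<theta>2 s\<bar>"
    have N0: "sqrt (real N) > 0" using N by (simp add: arm_numbers_def)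
    have "\<bar>diffusion_map policy x t N \<theta>1 s a - diffusion_map policy x t N \<theta>2 s a\<bar> \<le> K * ?d" for s a
    proof -
      have "\<bar>undiffuse x t N \<theta>1 s - undiffuse x t N \<theta>2 s\<bar> = sqrt (real N) * \<bar>\<theta>1 s - \<theta>2 s\<bar>" for s
        using N0 by (simp add: undiffuse_def abs_mult flip: right_diff_distrib)
      then have "\<bar>policy N t (undiffuse x t N \<theta>1) s a - policy N t (undiffuse x t N \<theta>2) s a\<bar>
          \<le> K * (sqrt (real N) * ?d)"
        using K(2)[OF t, of N "undiffuse x t N \<theta>1" s a "undiffuse x t N \<theta>2"]
        by (simp add: sum_distrib_left)
      moreover have "\<bar>diffusion_map policy x t N \<theta>1 s a - diffusion_map policy x t N \<theta>2 s a\<bar>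
          = \<bar>policy N t (undiffuse x t N \<theta>1) s a - policy N t (undiffuse x t N \<theta>2) s a\<bar> / sqrt (real N)"
        using N0 by (simp add: diffusion_map_def flip: diff_divide_distrib)
      ultimately show ?thesis using N0 by (simp add: divide_le_eq algebra_simps)
    qed
    then have "(\<Sum>s\<in>UNIV. \<Sum>a\<in>UNIV. \<bar>diffusion_map policy x t N \<theta>1 s a - diffusion_map policy x t N \<theta>2 s a\<bar>)
        \<le> 2 * real CARD('s) * (K * ?d)"
      unfolding sum_const[symmetric] by (intro sum_mono)
    moreover have "?d \<ge> 0" by (simp add: sum_nonneg)
    ultimately show ?thesis unfolding distrib_right mult.assoc by linarith
  qed
  have bounded: "(\<Sum>s\<in>UNIV. \<Sum>a\<in>UNIV. \<bar>diffusion_map policy x t N (\<lambda>s. 0) s a\<bar>)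
      \<le> 2 * real CARD('s) * K' + 1"
    if t: "t \<in> {1..T}" and N: "N \<in> arm_numbers T \<alpha>" for t N
  proof -
    have N1: "sqrt (real N) \<ge> 1" using N by (simp add: arm_numbers_def)
    have "\<bar>diffusion_map policy x t N (\<lambda>s. 0) s a\<bar> \<le> K'" for s a
    proof -
      have "undiffuse x t N (\<lambda>s. 0) = (\<lambda>s. real N * fluid_state x t s)"
        by (simp add: fun_eq_iff undiffuse_def)
      then have "\<bar>diffusion_map policy x t N (\<lambda>s. 0) s a\<bar>
          = \<bar>policy N t (\<lambda>s. real N * fluid_state x t s) s a - real N * x t s a\<bar> / sqrt (real N)"
        by (simp add: diffusion_map_def)
      also have "\<dots> \<le> K' / sqrt (real N)"
        using K'(2)[OF t] by (intro divide_right_mono) auto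
      also have "\<dots> \<le> K'" using K'(1) N1 by (simp add: divide_le_eq mult_left_le mult_le_cancel_left1)
      finally show ?thesis .
    qed
    then have "(\<Sum>s\<in>UNIV. \<Sum>a\<in>UNIV. \<bar>diffusion_map policy x t N (\<lambda>s. 0) s a\<bar>) \<le> 2 * real CARD('s) * K'"
      unfolding sum_const[symmetric] by (intro sum_mono)
    then show ?thesis by simp
  qed
  have "\<forall>t \<theta> s a. \<exists>l. t \<in> {1..T} \<longrightarrow>
      ((\<lambda>N. diffusion_map policy x t N \<theta> s a) \<longlongrightarrow> l) (to_infinity T \<alpha>)"
    using diffusion_map_tendsto by blast
  then obtain L where "\<And>t \<theta> s a. t \<in> {1..T} \<Longrightarrow>
      ((\<lambda>N. diffusion_map policy x t N \<theta> s a) \<longlongrightarrow> L t \<theta> s a) (to_infinity T \<alpha>)"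
    by metis
  moreover have "2 * real CARD('s) * K + 1 > 0" "2 * real CARD('s) * K' + 1 > 0"
    using K(1) K'(1) by (simp_all add: add_nonneg_pos)
  ultimately show ?thesis
    unfolding diffusion_regular_def using lipschitz bounded by blast
qed

end

section \<open>Fluctuations of independent moves\<close>

lemma expectation_bind_finite:
  fixes g :: "'b \<Rightarrow> real"
  assumes "finite (set_pmf M)" "\<And>x. finite (set_pmf (f x))"
  shows "measure_pmf.expectation (bind_pmf M f) g
    = measure_pmf.expectation M (\<lambda>x. measure_pmf.expectation (f x) g)"
  by (subst pmf_expectation_bind[of "set_pmf M"])
     (use assms in \<open>auto simp: integral_measure_pmf[of "set_pmf M"]\<close>)

lemma expectation_mono_finite:
  fixes f g :: "'a \<Rightarrow> real"
  assumes "finite (set_pmf M)" "\<And>x. f x \<le> g x"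
  shows "measure_pmf.expectation M f \<le> measure_pmf.expectation M g"
  by (rule integral_mono) (use assms in \<open>auto intro: integrable_measure_pmf_finite\<close>)

lemma expectation_sum_finite:
  fixes f :: "'i \<Rightarrow> 'a \<Rightarrow> real"
  assumes "finite (set_pmf M)"
  shows "measure_pmf.expectation M (\<lambda>x. \<Sum>i\<in>I. f i x) = (\<Sum>i\<in>I. measure_pmf.expectation M (f i))"
  by (rule Bochner_Integration.integral_sum) (rule integrable_measure_pmf_finite[OF assms])

lemma expectation_add_finite:
  fixes f g :: "'a \<Rightarrow> real"
  assumes "finite (set_pmf M)"
  shows "measure_pmf.expectation M (\<lambda>x. f x + g x)
    = measure_pmf.expectation M f + measure_pmf.expectation M g"
  by (rule Bochner_Integration.integral_add) (rule integrable_measure_pmf_finite[OF assms])+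

lemma finite_set_Pi_pmf:
  fixes q :: "'i \<Rightarrow> ('s::finite) pmf"
  assumes "finite A"
  shows "finite (set_pmf (Pi_pmf A d q))"
  by (rule finite_subset[OF set_Pi_pmf_subset'[OF assms]]) (auto intro: assms)

lemma state_counts_eq_sum: "state_counts N \<sigma> s = (\<Sum>i<N. of_bool (\<sigma> i = s))"
proof -
  have "(\<Sum>i<N. of_bool (\<sigma> i = s)) = real (card ({..<N} \<inter> {i. \<sigma> i = s}))"
    by (simp add: of_bool_def sum.If_cases)
  also have "{..<N} \<inter> {i. \<sigma> i = s} = {i. i < N \<and> \<sigma> i = s}" by auto
  finally show ?thesis by (simp add: state_counts_def)
qed

lemma expectation_Pi_pmf_state_counts:
  fixes q :: "nat \<Rightarrow> ('s::finite) pmf"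
  shows "measure_pmf.expectation (Pi_pmf {..<N} d q) (\<lambda>\<sigma>. state_counts N \<sigma> s) = (\<Sum>i<N. pmf (q i) s)"
proof -
  have "measure_pmf.expectation (Pi_pmf {..<N} d q) (\<lambda>\<sigma>. of_bool (\<sigma> i = s)) = pmf (q i) s"
    if "i < N" for i
  proof -
    have "measure_pmf.expectation (Pi_pmf {..<N} d q) (\<lambda>\<sigma>. of_bool (\<sigma> i = s) :: real)
        = measure_pmf.expectation (map_pmf (\<lambda>\<sigma>. \<sigma> i) (Pi_pmf {..<N} d q)) (\<lambda>y. of_bool (y = s))"
      by simp
    also have "\<dots> = measure_pmf.expectation (q i) (\<lambda>y. of_bool (y = s))"
      using that by (subst Pi_pmf_component) auto
    also have "\<dots> = measure_pmf.expectation (q i) (indicator {s})"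
      by (rule Bochner_Integration.integral_cong) auto
    finally show ?thesis by (simp add: pmf.rep_eq)
  qed
  then show ?thesis
    unfolding state_counts_eq_sum
    by (subst expectation_sum_finite) (simp_all add: finite_set_Pi_pmf del: sum_of_bool_eq)
qed

lemma expectation_Pi_pmf_lessThan_Suc:
  fixes q :: "nat \<Rightarrow> ('s::finite) pmf" and g :: "(nat \<Rightarrow> 's) \<Rightarrow> real"
  shows "measure_pmf.expectation (Pi_pmf {..<Suc n} d q) g
    = measure_pmf.expectation (q n)
        (\<lambda>y. measure_pmf.expectation (Pi_pmf {..<n} d q) (\<lambda>\<sigma>. g (\<sigma>(n := y))))"
proof -
  have "Pi_pmf {..<Suc n} d q = bind_pmf (q n) (\<lambda>y. map_pmf (\<lambda>\<sigma>. \<sigma>(n := y)) (Pi_pmf {..<n} d q))"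
    unfolding lessThan_Suc by (subst Pi_pmf_insert') (auto simp: map_pmf_def)
  then show ?thesis
    by (simp add: expectation_bind_finite finite_set_Pi_pmf)
qed

text \<open>
  By induction on \<open>N\<close>: a new arm adds an independent centred variable bounded by 1, so the cross
  term vanishes and the second moment grows by at most 1.
\<close>

lemma second_moment_state_counts:
  fixes q :: "nat \<Rightarrow> ('s::finite) pmf"
  shows "measure_pmf.expectation (Pi_pmf {..<N} d q)
    (\<lambda>\<sigma>. (state_counts N \<sigma> s - (\<Sum>i<N. pmf (q i) s))\<^sup>2) \<le> real N"
proof (induction N)
  case 0
  then show ?case by (simp add: state_counts_eq_sum)
next
  case (Suc n)
  let ?M = "Pi_pmf {..<n} d q"
  define W where "W = (\<lambda>\<sigma>. state_counts n \<sigma> s - (\<Sum>i<n. pmf (q i) s))"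
  define e where "e = (\<lambda>y. of_bool (y = s) - pmf (q n) s)"
  have fin: "finite (set_pmf ?M)" by (rule finite_set_Pi_pmf) simp
  note int = integrable_measure_pmf_finite[OF fin]
  have W0: "measure_pmf.expectation ?M W = 0"
    unfolding W_def by (subst Bochner_Integration.integral_diff[OF int int])
      (simp add: expectation_Pi_pmf_state_counts)
  have "measure_pmf.expectation ?M (\<lambda>\<sigma>. (W \<sigma> + e y)\<^sup>2) \<le> real n + 1" for y
  proof -
    have "\<bar>e y\<bar> \<le> 1" using pmf_nonneg[of "q n" s] pmf_le_1[of "q n" s] by (auto simp: e_def of_bool_def)
    then have "(e y)\<^sup>2 \<le> 1" by (simp add: abs_square_le_1)
    have "measure_pmf.expectation ?M (\<lambda>\<sigma>. (W \<sigma> + e y)\<^sup>2)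
        = measure_pmf.expectation ?M (\<lambda>\<sigma>. (W \<sigma>)\<^sup>2 + (2 * e y * W \<sigma> + (e y)\<^sup>2))"
      by (simp add: power2_sum algebra_simps)
    also have "\<dots> = measure_pmf.expectation ?M (\<lambda>\<sigma>. (W \<sigma>)\<^sup>2) + (e y)\<^sup>2"
      by (simp add: expectation_add_finite[OF fin] W0)
    finally show ?thesis using Suc \<open>(e y)\<^sup>2 \<le> 1\<close> by (simp add: W_def)
  qed
  then have "measure_pmf.expectation (q n) (\<lambda>y. measure_pmf.expectation ?M (\<lambda>\<sigma>. (W \<sigma> + e y)\<^sup>2))
      \<le> measure_pmf.expectation (q n) (\<lambda>y. real n + 1)"
    by (intro expectation_mono_finite) auto
  moreover have "state_counts (Suc n) (\<sigma>(n := y)) s - (\<Sum>i<Suc n. pmf (q i) s) = W \<sigma> + e y" for \<sigma> y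
    by (simp add: state_counts_eq_sum W_def e_def)
  ultimately show ?case
    by (simp add: expectation_Pi_pmf_lessThan_Suc)
qed

text \<open>
  From the second moment through \<open>2 sqrt N \<bar>w\<bar> \<le> w\<^sup>2 + N\<close>.
\<close>

lemma mean_deviation_state_counts:
  fixes q :: "nat \<Rightarrow> ('s::finite) pmf"
  assumes "N > 0"
  shows "measure_pmf.expectation (Pi_pmf {..<N} d q)
    (\<lambda>\<sigma>. \<bar>state_counts N \<sigma> s - (\<Sum>i<N. pmf (q i) s)\<bar>) \<le> sqrt (real N)"
proof -
  let ?M = "Pi_pmf {..<N} d q" and ?W = "\<lambda>\<sigma>. state_counts N \<sigma> s - (\<Sum>i<N. pmf (q i) s)"
  have fin: "finite (set_pmf ?M)" by (rule finite_set_Pi_pmf) simp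
  have N: "sqrt (real N) > 0" "(sqrt (real N))\<^sup>2 = real N" using assms by auto
  have "\<bar>w\<bar> \<le> w\<^sup>2 / (2 * sqrt (real N)) + sqrt (real N) / 2" for w
  proof -
    have "0 \<le> (\<bar>w\<bar> - sqrt (real N))\<^sup>2" by simp
    then have "2 * sqrt (real N) * \<bar>w\<bar> \<le> w\<^sup>2 + (sqrt (real N))\<^sup>2"
      by (simp add: power2_diff mult_ac)
    then show ?thesis using N(1) by (simp add: field_simps power2_eq_square)
  qed
  then have "measure_pmf.expectation ?M (\<lambda>\<sigma>. \<bar>?W \<sigma>\<bar>)
      \<le> measure_pmf.expectation ?M (\<lambda>\<sigma>. (?W \<sigma>)\<^sup>2 / (2 * sqrt (real N)) + sqrt (real N) / 2)"
    by (intro expectation_mono_finite[OF fin])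
  also have "\<dots> = measure_pmf.expectation ?M (\<lambda>\<sigma>. (?W \<sigma>)\<^sup>2) / (2 * sqrt (real N)) + sqrt (real N) / 2"
    by (simp add: expectation_add_finite[OF fin])
  also have "\<dots> \<le> real N / (2 * sqrt (real N)) + sqrt (real N) / 2"
    using second_moment_state_counts[of N d q s] by (intro add_right_mono divide_right_mono) auto
  also have "\<dots> = sqrt (real N)" using N by (simp add: field_simps)
  finally show ?thesis .
qed

section \<open>The process of joint states\<close>

definition action_counts :: "nat \<Rightarrow> 's rule \<Rightarrow> nat \<Rightarrow> (nat \<Rightarrow> 's) \<Rightarrow> 's \<Rightarrow> bool \<Rightarrow> real" where
  "action_counts N \<rho> t \<sigma> s a = (\<Sum>i<N. of_bool (\<sigma> i = s \<and> arm_action N \<rho> t \<sigma> i = a))"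

text \<open>
  The law of the joint state at time \<open>n + 1\<close> alone. Rewards and actions at a time depend only on the
  joint state at that time, so these marginals, which form a Markov chain, determine the value.
\<close>

definition config_law ::
  "(nat \<Rightarrow> 's \<Rightarrow> bool \<Rightarrow> 's pmf) \<Rightarrow> 's \<Rightarrow> nat \<Rightarrow> 's rule \<Rightarrow> nat \<Rightarrow> (nat \<Rightarrow> 's) pmf" where
  "config_law p s0 N \<rho> n = map_pmf (\<lambda>h. h (Suc n)) (trajectory p s0 N \<rho> n)"

lemma finite_set_trajectory:
  fixes p :: "nat \<Rightarrow> ('s::finite) \<Rightarrow> bool \<Rightarrow> 's pmf"
  shows "finite (set_pmf (trajectory p s0 N \<rho> n))"
  by (induction n) (auto simp: Let_def finite_set_Pi_pmf)

lemma finite_set_config_law: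
  fixes p :: "nat \<Rightarrow> ('s::finite) \<Rightarrow> bool \<Rightarrow> 's pmf"
  shows "finite (set_pmf (config_law p s0 N \<rho> n))"
  by (simp add: config_law_def finite_set_trajectory)

lemma config_law_0: "config_law p s0 N \<rho> 0 = return_pmf (\<lambda>i. s0)"
  by (simp add: config_law_def)

lemma config_law_Suc:
  "config_law p s0 N \<rho> (Suc n) = bind_pmf (config_law p s0 N \<rho> n)
     (\<lambda>\<sigma>. Pi_pmf {..<N} s0 (\<lambda>i. p (Suc n) (\<sigma> i) (arm_action N \<rho> (Suc n) \<sigma> i)))"
  by (simp add: config_law_def map_bind_pmf bind_map_pmf Let_def pmf.map_comp o_def)

lemma map_trajectory_eq_config_law:
  assumes "1 \<le> t" "t \<le> Suc n"
  shows "map_pmf (\<lambda>h. h t) (trajectory p s0 N \<rho> n) = config_law p s0 N \<rho> (t - 1)"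
  using assms(2)
proof (induction n)
  case 0
  then show ?case using assms(1) by (simp add: config_law_def)
next
  case (Suc n)
  show ?case
  proof (cases "t = Suc (Suc n)")
    case True
    then show ?thesis by (simp only: config_law_def) simp
  next
    case False
    then have "map_pmf (\<lambda>h. h t) (trajectory p s0 N \<rho> (Suc n)) = map_pmf (\<lambda>h. h t) (trajectory p s0 N \<rho> n)"
      by (simp add: map_bind_pmf Let_def pmf.map_comp o_def map_pmf_const)
         (simp add: map_pmf_def)
    then show ?thesis using Suc False by simp
  qed
qed

lemma sum_action_counts:
  fixes g :: "('s::finite) \<Rightarrow> bool \<Rightarrow> real"
  shows "(\<Sum>s\<in>UNIV. \<Sum>a\<in>UNIV. action_counts N \<rho> t \<sigma> s a * g s a)
    = (\<Sum>i<N. g (\<sigma> i) (arm_action N \<rho> t \<sigma> i))"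
proof -
  have "(\<Sum>s\<in>UNIV. \<Sum>a\<in>UNIV. action_counts N \<rho> t \<sigma> s a * g s a)
      = (\<Sum>s\<in>UNIV. \<Sum>a\<in>UNIV. \<Sum>i<N. of_bool (\<sigma> i = s \<and> arm_action N \<rho> t \<sigma> i = a) * g s a)"
    by (simp add: action_counts_def sum_distrib_right)
  also have "\<dots> = (\<Sum>s\<in>UNIV. \<Sum>i<N. \<Sum>a\<in>UNIV. of_bool (\<sigma> i = s \<and> arm_action N \<rho> t \<sigma> i = a) * g s a)"
    by (intro sum.cong refl sum.swap)
  also have "\<dots> = (\<Sum>i<N. \<Sum>s\<in>UNIV. \<Sum>a\<in>UNIV. of_bool (\<sigma> i = s \<and> arm_action N \<rho> t \<sigma> i = a) * g s a)"
    by (rule sum.swap)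
  also have "\<dots> = (\<Sum>i<N. g (\<sigma> i) (arm_action N \<rho> t \<sigma> i))"
  proof (intro sum.cong refl)
    fix i
    have "(\<Sum>a\<in>UNIV. of_bool (\<sigma> i = s \<and> arm_action N \<rho> t \<sigma> i = a) * g s a)
        = (if \<sigma> i = s then g s (arm_action N \<rho> t \<sigma> i) else 0)" for s
      by (cases "arm_action N \<rho> t \<sigma> i") (auto simp: UNIV_bool)
    then show "(\<Sum>s\<in>UNIV. \<Sum>a\<in>UNIV. of_bool (\<sigma> i = s \<and> arm_action N \<rho> t \<sigma> i = a) * g s a)
        = g (\<sigma> i) (arm_action N \<rho> t \<sigma> i)"
      by simp
  qed
  finally show ?thesis .
qed

lemma policy_value_eq:
  fixes p :: "nat \<Rightarrow> ('s::finite) \<Rightarrow> bool \<Rightarrow> 's pmf"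
  assumes "T \<ge> 1"
  shows "policy_value T p r s0 N \<rho> = (\<Sum>t\<in>{1..T}. \<Sum>s\<in>UNIV. \<Sum>a\<in>UNIV.
    r t s a * measure_pmf.expectation (config_law p s0 N \<rho> (t - 1)) (\<lambda>\<sigma>. action_counts N \<rho> t \<sigma> s a))"
proof -
  have "policy_value T p r s0 N \<rho> = (\<Sum>t\<in>{1..T}. measure_pmf.expectation (trajectory p s0 N \<rho> (T - 1))
      (\<lambda>h. \<Sum>i<N. r t (h t i) (arm_action N \<rho> t (h t) i)))"
    unfolding policy_value_def by (rule expectation_sum_finite[OF finite_set_trajectory])
  also have "\<dots> = (\<Sum>t\<in>{1..T}. measure_pmf.expectation (config_law p s0 N \<rho> (t - 1))
      (\<lambda>\<sigma>. \<Sum>i<N. r t (\<sigma> i) (arm_action N \<rho> t \<sigma> i)))"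
  proof (intro sum.cong refl)
    fix t assume "t \<in> {1..T}"
    then have "config_law p s0 N \<rho> (t - 1) = map_pmf (\<lambda>h. h t) (trajectory p s0 N \<rho> (T - 1))"
      using map_trajectory_eq_config_law[of t "T - 1" p s0 N \<rho>] by auto
    then show "measure_pmf.expectation (trajectory p s0 N \<rho> (T - 1))
        (\<lambda>h. \<Sum>i<N. r t (h t i) (arm_action N \<rho> t (h t) i))
      = measure_pmf.expectation (config_law p s0 N \<rho> (t - 1))
        (\<lambda>\<sigma>. \<Sum>i<N. r t (\<sigma> i) (arm_action N \<rho> t \<sigma> i))"
      by simp
  qed
  also have "\<dots> = (\<Sum>t\<in>{1..T}. \<Sum>s\<in>UNIV. \<Sum>a\<in>UNIV.
    r t s a * measure_pmf.expectation (config_law p s0 N \<rho> (t - 1)) (\<lambda>\<sigma>. action_counts N \<rho> t \<sigma> s a))"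
    unfolding sum_action_counts[symmetric]
    by (simp add: expectation_sum_finite[OF finite_set_config_law] mult.commute)
  finally show ?thesis .
qed

text \<open>
  The index condition says that fewer than \<open>k\<close> arms in the same state come before; it selects the
  first \<open>k\<close> of them, or all if there are fewer.
\<close>

lemma count_lowest_indices:
  fixes N :: nat
  shows "(\<Sum>i<N. of_bool (\<sigma> i = s \<and> card {j. j < i \<and> \<sigma> j = \<sigma> i} < k)) = min k (card {i. i < N \<and> \<sigma> i = s})"
proof (induction N)
  case (Suc n)
  have "{i. i < Suc n \<and> \<sigma> i = s} = (if \<sigma> n = s then insert n {i. i < n \<and> \<sigma> i = s} else {i. i < n \<and> \<sigma> i = s})"
    by (auto simp: less_Suc_eq)
  then have "card {i. i < Suc n \<and> \<sigma> i = s} = card {i. i < n \<and> \<sigma> i = s} + of_bool (\<sigma> n = s)"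
    by simp
  then show ?case using Suc by (auto simp: min_def)
qed simp

lemma sum_state_counts: "(\<Sum>s\<in>UNIV. state_counts N \<sigma> (s::'s::finite)) = real N"
proof -
  have "(\<Sum>s\<in>UNIV. state_counts N \<sigma> s) = (\<Sum>i<N. \<Sum>s\<in>UNIV. of_bool (\<sigma> i = s))"
    unfolding state_counts_eq_sum by (rule sum.swap)
  then show ?thesis by (simp add: of_bool_def)
qed

lemma sum_action_counts_bool:
  "(\<Sum>a\<in>UNIV. action_counts N \<rho> t \<sigma> s a) = state_counts N \<sigma> s"
  unfolding action_counts_def state_counts_eq_sum
  by (subst sum.swap, intro sum.cong refl) (auto simp: UNIV_bool)

text \<open>
  Pulling the arms of lowest index realises the prescribed counts exactly, since these never
  exceed the number of available arms.
\<close>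

lemma action_counts_feasible:
  fixes \<sigma> :: "nat \<Rightarrow> 's::finite"
  assumes feas: "feasible_rule T \<alpha> N \<rho>" and t: "t \<in> {1..T}"
  shows "action_counts N \<rho> t \<sigma> s a = \<rho> t (state_counts N \<sigma>) s a"
proof -
  let ?Z = "state_counts N \<sigma>"
  have Z: "(\<forall>s. ?Z s \<in> \<nat>) \<and> (\<Sum>s\<in>UNIV. ?Z s) = real N"
    by (simp add: sum_state_counts) (simp add: state_counts_def)
  have nat: "\<rho> t ?Z s a \<in> \<nat>" for a
    using feas t Z unfolding feasible_rule_def by blast
  have "(\<Sum>a\<in>UNIV. \<rho> t ?Z s a) = ?Z s"
    using feas t Z unfolding feasible_rule_def by blast
  then have split: "\<rho> t ?Z s True + \<rho> t ?Z s False = ?Z s"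
    by (simp add: UNIV_bool)
  obtain k l where k: "\<rho> t ?Z s True = real k" and l: "\<rho> t ?Z s False = real l"
    using nat by (meson Nats_cases)
  have "real (card {i. i < N \<and> \<sigma> i = s}) = real k + real l"
    using split unfolding k l by (simp add: state_counts_def)
  then have "k \<le> card {i. i < N \<and> \<sigma> i = s}" by linarith
  have pulled: "action_counts N \<rho> t \<sigma> s True = real k"
  proof -
    have "action_counts N \<rho> t \<sigma> s True
        = real (\<Sum>i<N. of_bool (\<sigma> i = s \<and> card {j. j < i \<and> \<sigma> j = \<sigma> i} < k))"
      unfolding action_counts_def of_nat_sum of_nat_of_bool
      by (intro sum.cong refl arg_cong[of _ _ of_bool]) (insert k, auto simp: arm_action_def)
    with \<open>k \<le> _\<close> show ?thesis by (simp add: count_lowest_indices)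
  qed
  have "action_counts N \<rho> t \<sigma> s True + action_counts N \<rho> t \<sigma> s False = ?Z s"
    using sum_action_counts_bool[of N \<rho> t \<sigma> s] by (simp add: UNIV_bool)
  with pulled split k show ?thesis by (cases a) auto
qed

section \<open>The linear program bounds every policy\<close>

text \<open>
  This turns a rule into a candidate for the linear program: all constraints hold when the rule is
  feasible, and the fluid reward is the value of the rule per arm.
\<close>

definition mean_occupation ::
  "(nat \<Rightarrow> 's \<Rightarrow> bool \<Rightarrow> 's pmf) \<Rightarrow> 's \<Rightarrow> nat \<Rightarrow> 's rule \<Rightarrow> 's occupation" where
  "mean_occupation p s0 N \<rho> t s a =
     measure_pmf.expectation (config_law p s0 N \<rho> (t - 1)) (\<lambda>\<sigma>. action_counts N \<rho> t \<sigma> s a) / real N"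

lemma expected_state_counts_Suc:
  fixes p :: "nat \<Rightarrow> ('s::finite) \<Rightarrow> bool \<Rightarrow> 's pmf"
  shows "measure_pmf.expectation (config_law p s0 N \<rho> (Suc n)) (\<lambda>\<sigma>. state_counts N \<sigma> s)
    = measure_pmf.expectation (config_law p s0 N \<rho> n)
        (\<lambda>\<sigma>. \<Sum>s'\<in>UNIV. \<Sum>a\<in>UNIV. action_counts N \<rho> (Suc n) \<sigma> s' a * pmf (p (Suc n) s' a) s)"
  by (simp add: config_law_Suc expectation_bind_finite finite_set_config_law finite_set_Pi_pmf
      expectation_Pi_pmf_state_counts sum_action_counts)

lemma occupation_measure_mean_occupation:
  fixes p :: "nat \<Rightarrow> ('s::finite) \<Rightarrow> bool \<Rightarrow> 's pmf"
  assumes feas: "feasible_rule T \<alpha> N \<rho>" and N: "N > 0" and T: "T \<ge> 1"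
  shows "occupation_measure T p \<alpha> s0 (mean_occupation p s0 N \<rho>)"
proof -
  let ?y = "mean_occupation p s0 N \<rho>"
  note fin = finite_set_config_law[of p s0 N \<rho>]
  have total: "(\<Sum>a\<in>UNIV. ?y t s a)
      = measure_pmf.expectation (config_law p s0 N \<rho> (t - 1)) (\<lambda>\<sigma>. state_counts N \<sigma> s) / real N" for t s
    unfolding mean_occupation_def sum_action_counts_bool[where \<rho> = \<rho> and t = t, symmetric]
    by (simp add: expectation_sum_finite[OF fin] sum_divide_distrib)
  have flow: "(\<Sum>a\<in>UNIV. ?y t s a) = (\<Sum>a\<in>UNIV. \<Sum>s'\<in>UNIV. ?y (t - 1) s' a * pmf (p (t - 1) s' a) s)"
    if t2: "t \<in> {2..T}" for t s
  proof -
    obtain n where t: "t = Suc (Suc n)" using t2 le_Suc_ex[of 2 t] by (auto simp: numeral_2_eq_2)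
    have "(\<Sum>a\<in>UNIV. ?y t s a) = (\<Sum>s'\<in>UNIV. \<Sum>a\<in>UNIV. ?y (t - 1) s' a * pmf (p (t - 1) s' a) s)"
      unfolding total
      unfolding mean_occupation_def t
      by (simp add: expected_state_counts_Suc expectation_sum_finite[OF fin] sum_divide_distrib)
    then show ?thesis by (subst sum.swap)
  qed
  have budget: "(\<Sum>s\<in>UNIV. ?y t s True) = \<alpha> t" if t: "t \<in> {1..T}" for t
  proof -
    have "(\<Sum>s\<in>UNIV. action_counts N \<rho> t \<sigma> s True) = \<alpha> t * real N" for \<sigma>
    proof -
      have "(\<forall>s. state_counts N \<sigma> s \<in> \<nat>) \<and> (\<Sum>s\<in>UNIV. state_counts N \<sigma> s) = real N"
        by (simp add: sum_state_counts) (simp add: state_counts_def)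
      then show ?thesis
        using feas t unfolding action_counts_feasible[OF feas t] feasible_rule_def by blast
    qed
    then have "measure_pmf.expectation (config_law p s0 N \<rho> (t - 1))
        (\<lambda>\<sigma>. \<Sum>s\<in>UNIV. action_counts N \<rho> t \<sigma> s True) = \<alpha> t * real N"
      by simp
    then show ?thesis
      using N by (simp add: mean_occupation_def expectation_sum_finite[OF fin] flip: sum_divide_distrib)
  qed
  have start: "(\<Sum>a\<in>UNIV. ?y 1 s a) = of_bool (s0 = s)" for s
    unfolding total using N by (simp add: config_law_0 state_counts_eq_sum)
  have nonneg: "?y t s a \<ge> 0" for t s a
    unfolding mean_occupation_def action_counts_def
    by (intro divide_nonneg_nonneg integral_nonneg sum_nonneg) auto
  show ?thesis
    unfolding occupation_measure_def using flow budget start nonneg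
    by (simp add: of_bool_def)
qed

lemma policy_value_eq_fluid_reward:
  fixes p :: "nat \<Rightarrow> ('s::finite) \<Rightarrow> bool \<Rightarrow> 's pmf"
  assumes "T \<ge> 1" "N > 0"
  shows "policy_value T p r s0 N \<rho> = real N * fluid_reward T r (mean_occupation p s0 N \<rho>)"
  using assms
  by (simp add: policy_value_eq fluid_reward_def mean_occupation_def sum_distrib_left)

lemma policy_value_le_fluid:
  fixes p :: "nat \<Rightarrow> ('s::finite) \<Rightarrow> bool \<Rightarrow> 's pmf"
  assumes "optimal_occupation_measure T p r \<alpha> s0 x" "T \<ge> 1" "N > 0" "feasible_rule T \<alpha> N \<rho>"
  shows "policy_value T p r s0 N \<rho> \<le> real N * fluid_reward T r x"
  using assms occupation_measure_mean_occupation[of T \<alpha> N \<rho> p s0]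
  by (simp add: policy_value_eq_fluid_reward optimal_occupation_measure_def)

text \<open>
  Feasibility of some rule makes the supremum range over a nonempty set; the linear program bounds
  that set from above.
\<close>

lemma optimal_value_le_fluid:
  fixes p :: "nat \<Rightarrow> ('s::finite) \<Rightarrow> bool \<Rightarrow> 's pmf"
  assumes "optimal_occupation_measure T p r \<alpha> s0 x" "T \<ge> 1" "N > 0" "feasible_rule T \<alpha> N \<rho>"
  shows "optimal_value T p r \<alpha> s0 N \<le> real N * fluid_reward T r x"
    and "policy_value T p r s0 N \<rho> \<le> optimal_value T p r \<alpha> s0 N"
proof -
  have ub: "policy_value T p r s0 N \<rho>' \<le> real N * fluid_reward T r x"
    if "\<rho>' \<in> {\<rho>. feasible_rule T \<alpha> N \<rho>}" for \<rho>'
    using policy_value_le_fluid[OF assms(1-3)] that by simp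
  show "optimal_value T p r \<alpha> s0 N \<le> real N * fluid_reward T r x"
    unfolding optimal_value_def by (rule cSUP_least) (use assms(4) ub in auto)
  show "policy_value T p r s0 N \<rho> \<le> optimal_value T p r \<alpha> s0 N"
    unfolding optimal_value_def
    by (rule cSUP_upper) (use assms(4) ub in \<open>auto intro!: bdd_aboveI2\<close>)
qed

section \<open>Concentration around the fluid trajectory\<close>

text \<open>
  The deviation after a move splits into the fluctuation around the conditional mean, at most
  \<open>sqrt N\<close>, and the deviation of that mean from \<open>z\<close>. The latter is a sum of action deviations
  weighted by transition probabilities.
\<close>

lemma state_deviation_Suc:
  fixes p :: "nat \<Rightarrow> ('s::finite) \<Rightarrow> bool \<Rightarrow> 's pmf"
  assumes "N > 0"
    and flow: "z = (\<Sum>s'\<in>UNIV. \<Sum>a\<in>UNIV. x s' a * pmf (p (Suc n) s' a) s)"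
  shows "measure_pmf.expectation (config_law p s0 N \<rho> (Suc n)) (\<lambda>\<sigma>. \<bar>state_counts N \<sigma> s - z\<bar>)
    \<le> sqrt (real N) + (\<Sum>s'\<in>UNIV. \<Sum>a\<in>UNIV. measure_pmf.expectation (config_law p s0 N \<rho> n)
          (\<lambda>\<sigma>. \<bar>action_counts N \<rho> (Suc n) \<sigma> s' a - x s' a\<bar>))"
proof -
  note fin = finite_set_config_law[of p s0 N \<rho>]
  have step: "measure_pmf.expectation
        (Pi_pmf {..<N} s0 (\<lambda>i. p (Suc n) (\<sigma> i) (arm_action N \<rho> (Suc n) \<sigma> i)))
        (\<lambda>\<sigma>'. \<bar>state_counts N \<sigma>' s - z\<bar>)
      \<le> sqrt (real N) + (\<Sum>s'\<in>UNIV. \<Sum>a\<in>UNIV. \<bar>action_counts N \<rho> (Suc n) \<sigma> s' a - x s' a\<bar>)"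
    (is "measure_pmf.expectation ?M _ \<le> _") for \<sigma>
  proof -
    let ?m = "\<Sum>i<N. pmf (p (Suc n) (\<sigma> i) (arm_action N \<rho> (Suc n) \<sigma> i)) s"
    have finM: "finite (set_pmf ?M)" by (rule finite_set_Pi_pmf) simp
    have "?m - z = (\<Sum>s'\<in>UNIV. \<Sum>a\<in>UNIV.
        (action_counts N \<rho> (Suc n) \<sigma> s' a - x s' a) * pmf (p (Suc n) s' a) s)"
      unfolding flow sum_action_counts[where g = "\<lambda>s' a. pmf (p (Suc n) s' a) s", symmetric]
      by (simp add: left_diff_distrib sum_subtractf)
    then have "\<bar>?m - z\<bar> \<le> (\<Sum>s'\<in>UNIV. \<Sum>a\<in>UNIV.
        \<bar>(action_counts N \<rho> (Suc n) \<sigma> s' a - x s' a) * pmf (p (Suc n) s' a) s\<bar>)"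
      by (auto intro!: order_trans[OF sum_abs] sum_mono)
    also have "\<dots> \<le> (\<Sum>s'\<in>UNIV. \<Sum>a\<in>UNIV. \<bar>action_counts N \<rho> (Suc n) \<sigma> s' a - x s' a\<bar>)"
      by (intro sum_mono) (simp add: abs_mult mult_left_le pmf_le_1)
    finally have drift: "\<bar>?m - z\<bar> \<le> \<dots>" .
    have "measure_pmf.expectation ?M (\<lambda>\<sigma>'. \<bar>state_counts N \<sigma>' s - z\<bar>)
        \<le> measure_pmf.expectation ?M (\<lambda>\<sigma>'. \<bar>state_counts N \<sigma>' s - ?m\<bar> + \<bar>?m - z\<bar>)"
      by (rule expectation_mono_finite[OF finM]) linarith
    also have "\<dots> = measure_pmf.expectation ?M (\<lambda>\<sigma>'. \<bar>state_counts N \<sigma>' s - ?m\<bar>) + \<bar>?m - z\<bar>"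
      by (simp add: expectation_add_finite[OF finM])
    also have "\<dots> \<le> sqrt (real N) + \<bar>?m - z\<bar>"
      by (intro add_right_mono mean_deviation_state_counts assms)
    finally show ?thesis using drift by linarith
  qed
  have "measure_pmf.expectation (config_law p s0 N \<rho> (Suc n)) (\<lambda>\<sigma>. \<bar>state_counts N \<sigma> s - z\<bar>)
      \<le> measure_pmf.expectation (config_law p s0 N \<rho> n) (\<lambda>\<sigma>. sqrt (real N)
          + (\<Sum>s'\<in>UNIV. \<Sum>a\<in>UNIV. \<bar>action_counts N \<rho> (Suc n) \<sigma> s' a - x s' a\<bar>))"
    unfolding config_law_Suc
    by (subst expectation_bind_finite[OF fin finite_set_Pi_pmf])
       (auto intro!: expectation_mono_finite[OF fin] step)
  also have "\<dots> = sqrt (real N) + (\<Sum>s'\<in>UNIV. \<Sum>a\<in>UNIV.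
      measure_pmf.expectation (config_law p s0 N \<rho> n)
          (\<lambda>\<sigma>. \<bar>action_counts N \<rho> (Suc n) \<sigma> s' a - x s' a\<bar>))"
    by (simp add: expectation_add_finite[OF fin] expectation_sum_finite[OF fin])
  finally show ?thesis .
qed

context fluid_priority_setting
begin

lemma policy_feasible:
  assumes N: "N \<in> arm_numbers T \<alpha>"
  shows "feasible_rule T \<alpha> N (policy N)"
  unfolding feasible_rule_def
proof (intro ballI allI impI)
  fix t and Z :: "'s \<Rightarrow> real"
  assume t: "t \<in> {1..T}" and Z: "(\<forall>s. Z s \<in> \<nat>) \<and> (\<Sum>s\<in>UNIV. Z s) = real N"
  let ?Y = "pulls N t Z"
  have nonneg: "x t s a \<ge> 0" for s a
    using occ t by (auto simp: occupation_measure_def)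
  have target: "of_int \<lfloor>real N * x t s True\<rfloor> \<in> (\<nat> :: real set)" for s
    using nonneg[of s True] by (simp add: Nats_altdef2)
  have budget: "\<alpha> t * real N \<in> \<nat>" "\<alpha> t * real N \<le> sum Z UNIV"
    using N budget_ratio[OF t] t Z by (auto simp: arm_numbers_def Nats_altdef2 mult_left_le_one_le)
  have Y: "?Y s \<in> \<nat>" "?Y s \<le> Z s" "sum ?Y UNIV = \<alpha> t * real N" for s
    unfolding fluid_priority_pulls_eq_passes
    using order[OF t] target budget Z states_partition[OF t]
    by (auto intro!: priority_passes_feasible simp: priority_order_def)
  show "(\<forall>s a. policy N t Z s a \<in> \<nat>) \<and>
        (\<forall>s. (\<Sum>a\<in>UNIV. policy N t Z s a) = Z s) \<and>
        (\<Sum>s\<in>UNIV. policy N t Z s True) = \<alpha> t * real N"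
    using Y Z by (auto simp: fluid_priority_policy_def Let_def UNIV_bool)
qed

text \<open>
  The rule is Lipschitz and is within a constant of \<open>N x\<close> on the fluid state, so deviations of the
  actions are controlled by deviations of the states.
\<close>

lemma policy_action_counts_deviation:
  shows "\<exists>K\<ge>0. \<forall>t\<in>{1..T}. \<forall>N\<in>arm_numbers T \<alpha>. \<forall>\<sigma> s a.
    \<bar>action_counts N (policy N) t \<sigma> s a - real N * x t s a\<bar>
      \<le> K * ((\<Sum>s\<in>UNIV. \<bar>state_counts N \<sigma> s - real N * fluid_state x t s\<bar>) + 1)"
proof -
  obtain K where K: "K \<ge> 0" "\<And>t N Z Z' s a. t \<in> {1..T} \<Longrightarrow>
    \<bar>policy N t Z s a - policy N t Z' s a\<bar> \<le> K * (\<Sum>s\<in>UNIV. \<bar>Z s - Z' s\<bar>)"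
    using policy_lipschitz by metis
  obtain K' where K': "K' \<ge> 0" "\<And>t N s a. t \<in> {1..T} \<Longrightarrow>
    \<bar>policy N t (\<lambda>s. real N * fluid_state x t s) s a - real N * x t s a\<bar> \<le> K'"
    using policy_at_fluid by metis
  have "\<bar>action_counts N (policy N) t \<sigma> s a - real N * x t s a\<bar>
      \<le> (K + K') * ((\<Sum>s\<in>UNIV. \<bar>state_counts N \<sigma> s - real N * fluid_state x t s\<bar>) + 1)"
    if t: "t \<in> {1..T}" and N: "N \<in> arm_numbers T \<alpha>" for t N \<sigma> s a
  proof -
    let ?d = "\<Sum>s\<in>UNIV. \<bar>state_counts N \<sigma> s - real N * fluid_state x t s\<bar>"
    have "feasible_rule T \<alpha> N (policy N)"
      by (rule policy_feasible[OF N])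
    then have "action_counts N (policy N) t \<sigma> s a = policy N t (state_counts N \<sigma>) s a"
      using t by (rule action_counts_feasible)
    then have "\<bar>action_counts N (policy N) t \<sigma> s a - real N * x t s a\<bar> \<le> K * ?d + K'"
      using K(2)[OF t, of N "state_counts N \<sigma>" s a "\<lambda>s. real N * fluid_state x t s"] K'(2)[OF t, of N s a]
      by linarith
    also have "\<dots> \<le> (K + K') * (?d + 1)"
    proof -
      have "0 \<le> K' * ?d" using K'(1) by (simp add: sum_nonneg)
      then show ?thesis using K(1) by (simp add: algebra_simps)
    qed
    finally show ?thesis .
  qed
  then show ?thesis using K(1) K'(1) by (intro exI[of _ "K + K'"]) auto
qed

text \<open>
  Induction over time. A bound \<open>D sqrt N\<close> on the mean deviation of the states passes to the actions
  by the Lipschitz property, and from the actions to the next states by one more random move. The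
  constant grows at each step, but the horizon is fixed. At the first time all arms are in \<open>s0\<close>
  and the states agree with the fluid state exactly.
\<close>

lemma policy_mean_deviation:
  assumes n: "n < T"
  shows "\<exists>D\<ge>0. \<forall>N\<in>arm_numbers T \<alpha>. \<forall>s a.
    measure_pmf.expectation (config_law p s0 N (policy N) n)
      (\<lambda>\<sigma>. \<bar>action_counts N (policy N) (Suc n) \<sigma> s a - real N * x (Suc n) s a\<bar>)
    \<le> D * sqrt (real N)"
proof -
  let ?law = "\<lambda>N. config_law p s0 N (policy N)"
  let ?dev = "\<lambda>N n s. measure_pmf.expectation (?law N n)
      (\<lambda>\<sigma>. \<bar>state_counts N \<sigma> s - real N * fluid_state x (Suc n) s\<bar>)"
  let ?act = "\<lambda>N n s a. measure_pmf.expectation (?law N n)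
      (\<lambda>\<sigma>. \<bar>action_counts N (policy N) (Suc n) \<sigma> s a - real N * x (Suc n) s a\<bar>)"
  obtain K where K0: "K \<ge> 0" and K: "\<forall>t\<in>{1..T}. \<forall>N\<in>arm_numbers T \<alpha>. \<forall>\<sigma> s a.
    \<bar>action_counts N (policy N) t \<sigma> s a - real N * x t s a\<bar>
      \<le> K * ((\<Sum>s\<in>UNIV. \<bar>state_counts N \<sigma> s - real N * fluid_state x t s\<bar>) + 1)"
    using policy_action_counts_deviation by (elim exE conjE)
  have sqrt1: "sqrt (real N) \<ge> 1" if "N \<in> arm_numbers T \<alpha>" for N
    using that by (simp add: arm_numbers_def)
  have actions: "?act N n s a \<le> K * (real CARD('s) * D + 1) * sqrt (real N)"
    if n: "n < T" and N: "N \<in> arm_numbers T \<alpha>" and D: "\<And>s. ?dev N n s \<le> D * sqrt (real N)"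
    for n N D s a
  proof -
    note fin = finite_set_config_law[of p s0 N "policy N" n]
    have "?act N n s a \<le> measure_pmf.expectation (?law N n)
        (\<lambda>\<sigma>. K * ((\<Sum>s\<in>UNIV. \<bar>state_counts N \<sigma> s - real N * fluid_state x (Suc n) s\<bar>) + 1))"
      using n N K by (intro expectation_mono_finite[OF fin]) auto
    also have "\<dots> = K * ((\<Sum>s\<in>UNIV. ?dev N n s) + 1)"
      by (simp add: expectation_add_finite[OF fin] expectation_sum_finite[OF fin])
    also have "\<dots> \<le> K * ((\<Sum>s\<in>(UNIV::'s set). D * sqrt (real N)) + sqrt (real N))"
      by (intro mult_left_mono add_mono sum_mono D sqrt1[OF N] K0)
    finally show ?thesis by (simp add: algebra_simps)
  qed
  have states: "\<exists>D\<ge>0. \<forall>N\<in>arm_numbers T \<alpha>. \<forall>s. ?dev N n s \<le> D * sqrt (real N)" if "n < T" for n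
    using that
  proof (induction n)
    case 0
    have start: "fluid_state x 1 s0 = 1" "(\<Sum>s\<in>UNIV. fluid_state x 1 s) = 1"
      using occ unfolding occupation_measure_def fluid_state_def by blast+
    have "x 1 s a \<ge> 0" for s a
      using occ 0 unfolding occupation_measure_def by auto
    then have nonneg: "fluid_state x 1 s \<ge> 0" for s
      unfolding fluid_state_def by (rule sum_nonneg)
    have "(\<Sum>s\<in>UNIV - {s0}. fluid_state x 1 s) = 0"
      using start by (simp add: sum.remove[of UNIV s0])
    then have "fluid_state x 1 s = of_bool (s0 = s)" for s
      using start(1) nonneg by (cases "s = s0") (auto simp: sum_nonneg_eq_0_iff)
    then show ?case
      by (intro exI[of _ 0]) (auto simp: config_law_0 state_counts_eq_sum)
  next
    case (Suc n)
    from Suc.IH[OF Suc_lessD[OF Suc.prems]]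
    obtain D where D: "D \<ge> 0" "\<And>N s. N \<in> arm_numbers T \<alpha> \<Longrightarrow> ?dev N n s \<le> D * sqrt (real N)"
      by blast
    let ?C = "K * (real CARD('s) * D + 1)"
    have "?dev N (Suc n) s \<le> (1 + 2 * real CARD('s) * ?C) * sqrt (real N)"
      if N: "N \<in> arm_numbers T \<alpha>" for N s
    proof -
      have "fluid_state x (Suc (Suc n)) s
          = (\<Sum>a\<in>UNIV. \<Sum>s'\<in>UNIV. x (Suc n) s' a * pmf (p (Suc n) s' a) s)"
      proof -
        have "\<forall>t\<in>{2..T}. \<forall>s. (\<Sum>a\<in>UNIV. x t s a) =
            (\<Sum>a\<in>UNIV. \<Sum>s'\<in>UNIV. x (t - 1) s' a * pmf (p (t - 1) s' a) s)"
          using occ unfolding occupation_measure_def by blast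
        from bspec[OF this, of "Suc (Suc n)"] show ?thesis
          using Suc.prems by (simp add: fluid_state_def)
      qed
      then have flow: "real N * fluid_state x (Suc (Suc n)) s
          = (\<Sum>s'\<in>UNIV. \<Sum>a\<in>UNIV. real N * x (Suc n) s' a * pmf (p (Suc n) s' a) s)"
        by (subst sum.swap) (simp add: sum_distrib_left mult.assoc)
      have "?dev N (Suc n) s \<le> sqrt (real N) + (\<Sum>s'\<in>UNIV. \<Sum>a\<in>UNIV. ?act N n s' a)"
        using N
        by (intro state_deviation_Suc[where p = p and n = n and x = "\<lambda>s a. real N * x (Suc n) s a", OF _ flow])
           (simp add: arm_numbers_def)
      also have "\<dots> \<le> sqrt (real N) + (\<Sum>s'\<in>(UNIV::'s set). \<Sum>a\<in>(UNIV::bool set). ?C * sqrt (real N))"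
        using Suc.prems by (intro add_left_mono sum_mono actions N D(2)) auto
      finally show ?thesis by (simp add: card_UNIV_bool algebra_simps)
    qed
    moreover have "1 + 2 * real CARD('s) * ?C \<ge> 0" using K0 D(1) by simp
    ultimately show ?case by blast
  qed
  from states[OF n] obtain D
    where D: "D \<ge> 0" "\<And>N s. N \<in> arm_numbers T \<alpha> \<Longrightarrow> ?dev N n s \<le> D * sqrt (real N)"
    by blast
  show ?thesis
  proof (intro exI[of _ "K * (real CARD('s) * D + 1)"] conjI ballI allI)
    show "0 \<le> K * (real CARD('s) * D + 1)" using K0 D(1) by simp
    show "?act N n s a \<le> K * (real CARD('s) * D + 1) * sqrt (real N)"
      if "N \<in> arm_numbers T \<alpha>" for N s a
      by (rule actions[OF n that D(2)[OF that]])
  qed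
qed

text \<open>
  Values are linear in the action counts, so the gap is at most the mean deviation of the action
  counts weighted by the absolute rewards.
\<close>

lemma policy_value_gap:
  assumes T: "T \<ge> 1"
  shows "\<exists>G. \<forall>N\<in>arm_numbers T \<alpha>.
    real N * fluid_reward T r x - policy_value T p r s0 N (policy N)
      \<le> G * sqrt (real N)"
proof -
  let ?law = "\<lambda>N. config_law p s0 N (policy N)"
  have "\<forall>n\<in>{..<T}. \<exists>D. \<forall>N\<in>arm_numbers T \<alpha>. \<forall>s a.
    measure_pmf.expectation (?law N n)
      (\<lambda>\<sigma>. \<bar>action_counts N (policy N) (Suc n) \<sigma> s a - real N * x (Suc n) s a\<bar>) \<le> D * sqrt (real N)"
    using policy_mean_deviation unfolding Ball_def lessThan_iff by blast
  from bchoice[OF this] obtain D where D: "\<And>n N s a. n < T \<Longrightarrow> N \<in> arm_numbers T \<alpha> \<Longrightarrow>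
    measure_pmf.expectation (?law N n)
      (\<lambda>\<sigma>. \<bar>action_counts N (policy N) (Suc n) \<sigma> s a - real N * x (Suc n) s a\<bar>) \<le> D n * sqrt (real N)"
    by (meson lessThan_iff)
  define G where "G = (\<Sum>t\<in>{1..T}. \<Sum>s\<in>UNIV. \<Sum>a\<in>UNIV. \<bar>r t s a\<bar> * D (t - 1))"
  have "real N * fluid_reward T r x - policy_value T p r s0 N (policy N) \<le> G * sqrt (real N)"
    if N: "N \<in> arm_numbers T \<alpha>" for N
  proof -
    note fin = finite_set_config_law[of p s0 N "policy N"]
    have "r t s a * (real N * x t s a - measure_pmf.expectation (?law N (t - 1))
          (\<lambda>\<sigma>. action_counts N (policy N) t \<sigma> s a)) \<le> \<bar>r t s a\<bar> * (D (t - 1) * sqrt (real N))"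
      (is "_ * (_ - ?e) \<le> _") if t: "t \<in> {1..T}" for t s a
    proof -
      have "?e - real N * x t s a = measure_pmf.expectation (?law N (t - 1))
          (\<lambda>\<sigma>. action_counts N (policy N) t \<sigma> s a - real N * x t s a)"
        by (simp add: Bochner_Integration.integral_diff integrable_measure_pmf_finite[OF fin])
      then have "\<bar>?e - real N * x t s a\<bar> \<le> measure_pmf.expectation (?law N (t - 1))
          (\<lambda>\<sigma>. \<bar>action_counts N (policy N) t \<sigma> s a - real N * x t s a\<bar>)"
        by simp
      also have "\<dots> \<le> D (t - 1) * sqrt (real N)"
        using D[of "t - 1" N s a] t N by auto
      finally have "\<bar>real N * x t s a - ?e\<bar> \<le> D (t - 1) * sqrt (real N)"
        by (simp add: abs_minus_commute)
      then have "\<bar>r t s a\<bar> * \<bar>real N * x t s a - ?e\<bar> \<le> \<bar>r t s a\<bar> * (D (t - 1) * sqrt (real N))"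
        by (rule mult_left_mono) simp
      then show ?thesis by (simp flip: abs_mult)
    qed
    then have "(\<Sum>t\<in>{1..T}. \<Sum>s\<in>UNIV. \<Sum>a\<in>UNIV. r t s a * (real N * x t s a
        - measure_pmf.expectation (?law N (t - 1)) (\<lambda>\<sigma>. action_counts N (policy N) t \<sigma> s a)))
      \<le> (\<Sum>t\<in>{1..T}. \<Sum>s\<in>UNIV. \<Sum>a\<in>UNIV. \<bar>r t s a\<bar> * (D (t - 1) * sqrt (real N)))"
      by (intro sum_mono)
    then show ?thesis
      unfolding policy_value_eq[OF T] fluid_reward_def G_def
      by (simp add: sum_distrib_left sum_distrib_right sum_subtractf algebra_simps)
  qed
  then show ?thesis by blast
qed

end

section \<open>Diffusion regularity and the optimality gap\<close>

theorem theorem3: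
  fixes T :: nat
    and p :: "nat \<Rightarrow> 's::finite \<Rightarrow> bool \<Rightarrow> 's pmf"
    and r :: "nat \<Rightarrow> 's \<Rightarrow> bool \<Rightarrow> real"
    and \<alpha> :: "nat \<Rightarrow> real"
    and s0 :: 's
    and x :: "nat \<Rightarrow> 's \<Rightarrow> bool \<Rightarrow> real"
    and P :: "nat \<Rightarrow> 's \<Rightarrow> real"
    and ord :: "nat \<Rightarrow> 's list"
  assumes "T \<ge> 1"
    and "\<And>t. t \<in> {1..T} \<Longrightarrow> \<alpha> t \<in> \<rat> \<and> 0 \<le> \<alpha> t \<and> \<alpha> t \<le> 1"
    and "optimal_occupation_measure T p r \<alpha> s0 x"
    and "\<And>t. t \<in> {1..T} \<Longrightarrow> priority_order (P t) (ord t)"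
  shows "diffusion_regular T \<alpha> x (fluid_priority_policy \<alpha> x ord) \<and>
    (\<lambda>N. optimal_value T p r \<alpha> s0 N
          - policy_value T p r s0 N (fluid_priority_policy \<alpha> x ord N))
      \<in> O[to_infinity T \<alpha>](\<lambda>N. sqrt (real N))"
proof
  interpret fluid_priority_setting T p \<alpha> s0 x P ord
    using assms by unfold_locales (auto simp: optimal_occupation_measure_def)
  show "diffusion_regular T \<alpha> x (fluid_priority_policy \<alpha> x ord)"
    by (rule policy_diffusion_regular)
  obtain G where G: "\<And>N. N \<in> arm_numbers T \<alpha> \<Longrightarrow>
    real N * fluid_reward T r x - policy_value T p r s0 N (policy N) \<le> G * sqrt (real N)"
    using policy_value_gap[OF assms(1)] by blast
  show "(\<lambda>N. optimal_value T p r \<alpha> s0 N - policy_value T p r s0 N (policy N))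
      \<in> O[to_infinity T \<alpha>](\<lambda>N. sqrt (real N))"
  proof (rule bigoI[where c = G], rule eventually_to_infinity)
    fix N assume N: "N \<in> arm_numbers T \<alpha>"
    then have "N > 0" by (simp add: arm_numbers_def)
    from optimal_value_le_fluid[OF assms(3,1) this policy_feasible[OF N]] G[OF N]
    show "norm (optimal_value T p r \<alpha> s0 N - policy_value T p r s0 N (policy N))
        \<le> G * norm (sqrt (real N))"
      by simp
  qed
qed

end
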